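(* Let $F$ be a solution of the $G_{n,n}$-system, $E$ a frame of $F$, $0\ne s\in\mathbb R$ a constant, $\beta\in O(n)$ a constant matrix, and $$k_{s,\beta}(\lambda)=\frac1{\lambda-is}\begin{pmatrix}s\beta&\lambda I\\-\lambda I&s\beta^t\end{pmatrix}.$$ Write $E(x,-is)=\begin{pmatrix}\eta_1(x)&\eta_2(x)\\\eta_3(x)&\eta_4(x)\end{pmatrix}$ with $n\times n$ blocks $\eta_i$. Set $$\tilde\beta=(i\eta_4-\beta\eta_2)^{-1}(i\beta\eta_1+\eta_3),\qquad\tilde E(x,\lambda)=k_{s,\beta}(\lambda)E(x,\lambda)k_{s,\tilde\beta(x)}(\lambda)^{-1},\qquad\tilde F=F^t+s\tilde\beta_*,$$ where $y_*$ is the matrix whose $ij$-th entry is $y_{ij}$ for $i\ne j$ and $0$ for $i=j$. Then: (i) $\tilde F$ is a solution of the $G_{n,n}$-system and $\tilde E$ is a frame of $\tilde F$; (ii) $\tilde\beta$ is a solution of $$d\tilde\beta=\sum_{i=1}^n\left(-\tilde\beta(FC_i-C_iF^t)+(F^tC_i-C_iF)\tilde\beta-sC_i+s\tilde\beta C_i\tilde\beta\right)dx_i,\qquad\tilde\beta\tilde\beta^t=I.$$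
   Context: $gl_*(n)$: real $n\times n$ matrices with zero diagonal; $C_i$: the $n\times n$ matrix whose only non-zero entry is a $1$ at $(i,i)$; $\delta=\mathrm{diag}(dx_1,\dots,dx_n)$. A map $F:\mathbb R^n\to gl_*(n)$ is a solution of the $G_{n,n}$-system if $$\theta_\lambda=\lambda\begin{pmatrix}0&-\delta\\\delta&0\end{pmatrix}+\begin{pmatrix}-F\delta+\delta F^t&0\\0&-F^t\delta+\delta F\end{pmatrix}$$ is flat ($d\theta_\lambda+\theta_\lambda\wedge\theta_\lambda=0$) for all $\lambda\in\mathbb C$. A frame of $F$ is a trivialization of this Lax connection, $E^{-1}dE=\theta_\lambda$, satisfying the $G_{n,n}$-reality condition $\overline{E(x,\bar\lambda)}=E(x,\lambda)$, $I_{n,n}E(x,\lambda)I_{n,n}^{-1}=E(x,-\lambda)$, $EE^t=I$, where $I_{n,n}=\mathrm{diag}(I_n,-I_n)$. *)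

theory Defs
  imports "HOL-Analysis.Analysis"
begin

text \<open>
  The dimension \<open>n\<close> is \<open>CARD('n)\<close>; block matrices of size \<open>2n\<close> are indexed by \<open>'n + 'n\<close>.
  A matrix-valued 1-form on \<open>real ^ 'n\<close> is a function taking a point and a tangent vector,
  linear in the latter. The spectral parameter is called \<open>\<mu>\<close>.
\<close>

definition cscale :: "'a::times \<Rightarrow> 'a ^ 'm ^ 'k \<Rightarrow> 'a ^ 'm ^ 'k"  (infixr \<open>*c\<close> 75)
  where "c *c A = map_matrix ((*) c) A"

abbreviation cmat :: "real ^ 'm ^ 'k \<Rightarrow> complex ^ 'm ^ 'k"
  where "cmat \<equiv> map_matrix complex_of_real"

definition block ::
  "'a ^ 'n ^ 'n \<Rightarrow> 'a ^ 'n ^ 'n \<Rightarrow> 'a ^ 'n ^ 'n \<Rightarrow> 'a ^ 'n ^ 'n \<Rightarrow> 'a ^ ('n + 'n) ^ ('n + 'n)"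
  where "block P Q R S = (\<chi> i j.
    case i of
      Inl a \<Rightarrow> (case j of Inl b \<Rightarrow> P $ a $ b | Inr b \<Rightarrow> Q $ a $ b)
    | Inr a \<Rightarrow> (case j of Inl b \<Rightarrow> R $ a $ b | Inr b \<Rightarrow> S $ a $ b))"

definition blk11 :: "'a ^ ('n + 'n) ^ ('n + 'n) \<Rightarrow> 'a ^ 'n ^ 'n"
  where "blk11 M = (\<chi> a b. M $ Inl a $ Inl b)"

definition blk12 :: "'a ^ ('n + 'n) ^ ('n + 'n) \<Rightarrow> 'a ^ 'n ^ 'n"
  where "blk12 M = (\<chi> a b. M $ Inl a $ Inr b)"

definition blk21 :: "'a ^ ('n + 'n) ^ ('n + 'n) \<Rightarrow> 'a ^ 'n ^ 'n"
  where "blk21 M = (\<chi> a b. M $ Inr a $ Inl b)"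

definition blk22 :: "'a ^ ('n + 'n) ^ ('n + 'n) \<Rightarrow> 'a ^ 'n ^ 'n"
  where "blk22 M = (\<chi> a b. M $ Inr a $ Inr b)"

definition Inn :: "complex ^ ('n::finite + 'n) ^ ('n + 'n)"
  where "Inn = block (mat 1) 0 0 (- mat 1)"

definition Cunit :: "'n \<Rightarrow> real ^ 'n ^ 'n"
  where "Cunit i = (\<chi> j k. if j = i \<and> k = i then 1 else 0)"

definition gl_star :: "(real ^ 'n ^ 'n) set"
  where "gl_star = {A. \<forall>i. A $ i $ i = 0}"

definition off_diag :: "real ^ 'n ^ 'n \<Rightarrow> real ^ 'n ^ 'n"
  where "off_diag A = (\<chi> i j. if i = j then 0 else A $ i $ j)"

fun C_k :: "nat \<Rightarrow> (real ^ 'n \<Rightarrow> 'b::real_normed_vector) \<Rightarrow> bool" where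
  "C_k 0 f \<longleftrightarrow> continuous_on UNIV f"
| "C_k (Suc k) f \<longleftrightarrow> (\<forall>x. f differentiable (at x)) \<and>
     (\<forall>i. C_k k (\<lambda>x. frechet_derivative f (at x) (axis i 1)))"

definition smooth :: "(real ^ 'n \<Rightarrow> 'b::real_normed_vector) \<Rightarrow> bool"
  where "smooth f \<longleftrightarrow> (\<forall>k. C_k k f)"

definition delta :: "real ^ 'n \<Rightarrow> complex ^ 'n ^ 'n"
  where "delta v = (\<chi> i j. if i = j then complex_of_real (v $ i) else 0)"

definition theta ::
  "(real ^ 'n \<Rightarrow> real ^ 'n ^ 'n) \<Rightarrow> complex \<Rightarrow> real ^ 'n \<Rightarrow> real ^ 'n \<Rightarrow> complex ^ ('n + 'n) ^ ('n + 'n)"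
  where "theta F \<mu> x v =
    (let f = cmat (F x); d = delta v in
      \<mu> *c block 0 (- d) d 0
      + block (- (f ** d) + d ** transpose f) 0 0 (- (transpose f ** d) + d ** f))"

definition ext_deriv ::
  "(real ^ 'n \<Rightarrow> real ^ 'n \<Rightarrow> 'a::real_normed_vector) \<Rightarrow> real ^ 'n \<Rightarrow> real ^ 'n \<Rightarrow> real ^ 'n \<Rightarrow> 'a"
  where "ext_deriv \<omega> x u v =
    frechet_derivative (\<lambda>y. \<omega> y v) (at x) u - frechet_derivative (\<lambda>y. \<omega> y u) (at x) v"

definition wedge ::
  "(real ^ 'n \<Rightarrow> real ^ 'n \<Rightarrow> complex ^ 'm ^ 'm) \<Rightarrow> (real ^ 'n \<Rightarrow> real ^ 'n \<Rightarrow> complex ^ 'm ^ 'm)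
    \<Rightarrow> real ^ 'n \<Rightarrow> real ^ 'n \<Rightarrow> real ^ 'n \<Rightarrow> complex ^ 'm ^ 'm"
  where "wedge \<omega> \<eta> x u v = \<omega> x u ** \<eta> x v - \<omega> x v ** \<eta> x u"

definition flat :: "(real ^ 'n \<Rightarrow> real ^ 'n \<Rightarrow> complex ^ 'm ^ 'm) \<Rightarrow> bool"
  where "flat \<omega> \<longleftrightarrow> (\<forall>x u v. ext_deriv \<omega> x u v + wedge \<omega> \<omega> x u v = 0)"

text \<open>Maps are smooth, as usual in differential geometry.\<close>

definition is_solution :: "(real ^ 'n \<Rightarrow> real ^ 'n ^ 'n) \<Rightarrow> bool"
  where "is_solution F \<longleftrightarrow> smooth F \<and> (\<forall>x. F x \<in> gl_star) \<and> (\<forall>\<mu>. flat (theta F \<mu>))"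

definition trivialization ::
  "(real ^ 'n \<Rightarrow> real ^ 'n \<Rightarrow> complex ^ 'm ^ 'm) \<Rightarrow> (real ^ 'n \<Rightarrow> complex ^ 'm ^ 'm) \<Rightarrow> bool"
  where "trivialization \<omega> g \<longleftrightarrow>
    (\<forall>x. invertible (g x) \<and> g differentiable (at x) \<and>
      (\<forall>v. matrix_inv (g x) ** frechet_derivative g (at x) v = \<omega> x v))"

definition reality_condition ::
  "(real ^ 'n \<Rightarrow> complex \<Rightarrow> complex ^ ('m::finite + 'm) ^ ('m + 'm)) \<Rightarrow> bool"
  where "reality_condition E \<longleftrightarrow>
    (\<forall>x \<mu>. map_matrix cnj (E x (cnj \<mu>)) = E x \<mu> \<and>
           Inn ** E x \<mu> ** matrix_inv Inn = E x (- \<mu>) \<and>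
           E x \<mu> ** transpose (E x \<mu>) = mat 1)"

definition is_frame ::
  "(real ^ 'n \<Rightarrow> real ^ 'n ^ 'n) \<Rightarrow> (real ^ 'n \<Rightarrow> complex \<Rightarrow> complex ^ ('n + 'n) ^ ('n + 'n)) \<Rightarrow> bool"
  where "is_frame F E \<longleftrightarrow>
    (\<forall>\<mu>. trivialization (theta F \<mu>) (\<lambda>x. E x \<mu>)) \<and> reality_condition E"

text \<open>Not part of the definition of a frame; see the theorem for its use.\<close>

definition entire_in_parameter ::
  "(real ^ 'n \<Rightarrow> complex \<Rightarrow> complex ^ 'm ^ 'm) \<Rightarrow> bool"
  where "entire_in_parameter E \<longleftrightarrow> (\<forall>x i j. (\<lambda>\<mu>. E x \<mu> $ i $ j) holomorphic_on UNIV)"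

definition kmat :: "real \<Rightarrow> real ^ 'n ^ 'n \<Rightarrow> complex \<Rightarrow> complex ^ ('n + 'n) ^ ('n + 'n)"
  where "kmat s \<beta> \<mu> = (1 / (\<mu> - \<i> * of_real s)) *c
    block (of_real s *c cmat \<beta>) (\<mu> *c mat 1) (- (\<mu> *c mat 1)) (of_real s *c transpose (cmat \<beta>))"

text \<open>
  The matrix \<open>\<beta>~ = (i \<eta>4 - \<beta> \<eta>2)\<^sup>-\<^sup>1 (i \<beta> \<eta>1 + \<eta>3)\<close> is \<open>matrix_inv (beta_den s \<beta> E x) ** beta_num s \<beta> E x\<close>.
\<close>

definition beta_den ::
  "real \<Rightarrow> real ^ 'n ^ 'n \<Rightarrow> (real ^ 'n \<Rightarrow> complex \<Rightarrow> complex ^ ('n + 'n) ^ ('n + 'n))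
    \<Rightarrow> real ^ 'n \<Rightarrow> complex ^ 'n ^ 'n"
  where "beta_den s \<beta> E x =
    (let M = E x (- \<i> * of_real s) in \<i> *c blk22 M - cmat \<beta> ** blk12 M)"

definition beta_num ::
  "real \<Rightarrow> real ^ 'n ^ 'n \<Rightarrow> (real ^ 'n \<Rightarrow> complex \<Rightarrow> complex ^ ('n + 'n) ^ ('n + 'n))
    \<Rightarrow> real ^ 'n \<Rightarrow> complex ^ 'n ^ 'n"
  where "beta_num s \<beta> E x =
    (let M = E x (- \<i> * of_real s) in \<i> *c (cmat \<beta> ** blk11 M) + blk21 M)"

text \<open>
  The formula for the transformed frame makes no sense at \<open>\<mu> = is\<close> (pole of \<open>k\<close>) and at
  \<open>\<mu> = -is\<close> (\<open>k\<close> is singular). A map \<open>E'\<close> defined for all \<open>\<mu>\<close> is required to agree with it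
  elsewhere; if \<open>E\<close> and \<open>E'\<close> are entire in \<open>\<mu>\<close>, then \<open>E'\<close> is the unique holomorphic extension.
\<close>

definition is_dressed ::
  "real \<Rightarrow> real ^ 'n ^ 'n \<Rightarrow> (real ^ 'n \<Rightarrow> real ^ 'n ^ 'n)
    \<Rightarrow> (real ^ 'n \<Rightarrow> complex \<Rightarrow> complex ^ ('n + 'n) ^ ('n + 'n))
    \<Rightarrow> (real ^ 'n \<Rightarrow> complex \<Rightarrow> complex ^ ('n + 'n) ^ ('n + 'n)) \<Rightarrow> bool"
  where "is_dressed s \<beta> b E E' \<longleftrightarrow>
    (\<forall>x \<mu>. \<mu> \<noteq> \<i> * of_real s \<and> \<mu> \<noteq> - \<i> * of_real s \<longrightarrow>
      invertible (kmat s (b x) \<mu>) \<and>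
      E' x \<mu> = kmat s \<beta> \<mu> ** E x \<mu> ** matrix_inv (kmat s (b x) \<mu>))"

end

(*
  The dressing factor k has a simple pole at is and is singular at -is. The rows of k(-is) span the
  graph (i beta, I); multiplying it by E(-is) gives Q (i b, I) with b = beta~, the reality condition
  makes b real, and E E^t = I makes b orthogonal. Differentiating this relation gives the Riccati
  system for b. That system is exactly the condition theta K^t + dK^t = K^t theta' for the numerator
  K of k_{s,b}, so the dressed map is a frame off the poles; flatness of theta' is a polynomial
  identity in b, F and dF.

  At the two poles a frame is obtained as a limit along the imaginary axis: for parallel maps whose
  connection forms converge, convergence at one point propagates to all points, and the limit is
  parallel. If E is entire in the parameter, the numerator vanishes at the poles, so the limit is the
  holomorphic extension; otherwise one normalises at the origin before taking the limit.
*)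

theory Submission
  imports Defs "HOL-Complex_Analysis.Cauchy_Integral_Formula"
begin

section \<open>Matrix algebra\<close>

text \<open>The row block (i \<beta>, I) is isotropic for the complex bilinear form preserved by
  E(-is), because \<beta> is orthogonal, and so is its image under E(-is). The reality condition
  gives this image the form (i \<open>num\<close>, \<open>den\<close>) with real \<open>num\<close>
  and \<open>den\<close>, so isotropy reads \<open>num\<close> \<open>num\<close>^t =
  \<open>den\<close> \<open>den\<close>^t. Positivity of the real inner product turns this into
  invertibility of \<open>den\<close>, and cancelling \<open>den\<close> gives orthogonality of b.

  The curvature of \<open>theta\<close> does not depend on the parameter, so flatness for all
  parameters is a single condition. It splits into one identity for F and one for F^t, which are
  exchanged by transposing F and b together.

  A frame must exist at every parameter value, but the definition imposes no regularity in the
  parameter. The given frame therefore supplies neither continuity nor holomorphy at the poles. What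
  remains is that the connection forms are Lipschitz in the parameter, uniformly in x, and that
  convergence of parallel maps spreads from one point; the two existence proofs differ only in how
  they obtain convergence at the origin.\<close>

lemma matrix_add_rdistrib:
  fixes A B :: "'a::semiring_1 ^ 'n ^ 'm" and C :: "'a ^ 'p ^ 'n"
  shows "(A + B) ** C = A ** C + B ** C"
  by (simp add: vec_eq_iff matrix_matrix_mult_def sum.distrib distrib_right)

lemma matrix_minus_left:
  fixes A :: "'a::ring_1 ^ 'n ^ 'm" and C :: "'a ^ 'p ^ 'n"
  shows "(- A) ** C = - (A ** C)"
  by (simp add: vec_eq_iff matrix_matrix_mult_def sum_negf)

lemma matrix_minus_right:
  fixes A :: "'a::ring_1 ^ 'n ^ 'm" and C :: "'a ^ 'p ^ 'n"
  shows "A ** (- C) = - (A ** C)"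
  by (simp add: vec_eq_iff matrix_matrix_mult_def sum_negf)

lemma matrix_diff_ldistrib:
  fixes A :: "'a::ring_1 ^ 'n ^ 'm" and B C :: "'a ^ 'p ^ 'n"
  shows "A ** (B - C) = A ** B - A ** C"
  by (simp add: vec_eq_iff matrix_matrix_mult_def sum_subtractf right_diff_distrib)

lemma matrix_diff_rdistrib:
  fixes A B :: "'a::ring_1 ^ 'n ^ 'm" and C :: "'a ^ 'p ^ 'n"
  shows "(A - B) ** C = A ** C - B ** C"
  by (simp add: vec_eq_iff matrix_matrix_mult_def sum_subtractf left_diff_distrib)

lemma matrix_scaleR_left:
  fixes A :: "'a::real_algebra_1 ^ 'n ^ 'm" and C :: "'a ^ 'p ^ 'n"
  shows "(k *\<^sub>R A) ** C = k *\<^sub>R (A ** C)"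
  by (simp add: scalar_matrix_assoc)

lemma matrix_scaleR_right:
  fixes A :: "'a::real_algebra_1 ^ 'n ^ 'm" and C :: "'a ^ 'p ^ 'n"
  shows "A ** (k *\<^sub>R C) = k *\<^sub>R (A ** C)"
  by (simp add: matrix_scalar_ac scalar_matrix_assoc)

lemma matrix_cscale_left:
  fixes A :: "'a::comm_ring_1 ^ 'n ^ 'm" and C :: "'a ^ 'p ^ 'n"
  shows "(k *c A) ** C = k *c (A ** C)"
  by (simp add: vec_eq_iff matrix_matrix_mult_def cscale_def sum_distrib_left mult.assoc)

lemma matrix_cscale_right:
  fixes A :: "'a::comm_ring_1 ^ 'n ^ 'm" and C :: "'a ^ 'p ^ 'n"
  shows "A ** (k *c C) = k *c (A ** C)"
  by (simp add: vec_eq_iff matrix_matrix_mult_def cscale_def sum_distrib_left mult_ac)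

lemmas matrix_distribs =
  matrix_add_ldistrib matrix_add_rdistrib matrix_diff_ldistrib matrix_diff_rdistrib
  matrix_minus_left matrix_minus_right matrix_scaleR_left matrix_scaleR_right
  matrix_cscale_left matrix_cscale_right matrix_mul_assoc

lemma cscale_simps [simp]:
  fixes A B :: "'a::comm_ring_1 ^ 'n ^ 'm"
  shows "a *c (b *c A) = (a * b) *c A" "1 *c A = A" "0 *c A = 0" "a *c (0 :: 'a ^ 'n ^ 'm) = 0"
    "(- a) *c A = - (a *c A)" "a *c (- A) = - (a *c A)"
  by (simp_all add: vec_eq_iff cscale_def mult.assoc)

lemma cscale_distribs:
  fixes A B :: "'a::comm_ring_1 ^ 'n ^ 'm"
  shows "a *c (A + B) = a *c A + a *c B" "a *c (A - B) = a *c A - a *c B"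
    "(a + b) *c A = a *c A + b *c A" "(a - b) *c A = a *c A - b *c A"
  by (simp_all add: vec_eq_iff cscale_def algebra_simps)

lemma transpose_simps [simp]:
  fixes A B :: "'a::comm_ring_1 ^ 'n ^ 'm"
  shows "transpose (A + B) = transpose A + transpose B"
    "transpose (A - B) = transpose A - transpose B"
    "transpose (- A) = - transpose A"
    "transpose (0 :: 'a ^ 'n ^ 'm) = 0"
    "transpose (a *c A) = a *c transpose A"
  by (simp_all add: vec_eq_iff transpose_def cscale_def)

lemma cmat_simps:
  "cmat (A + B) = cmat A + cmat B"
  "cmat (A - B) = cmat A - cmat B"
  "cmat (- A) = - cmat A"
  "cmat 0 = 0"
  "cmat (mat 1) = mat 1"
  "cmat (r *\<^sub>R A) = complex_of_real r *c cmat A"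
  "cmat (transpose A) = transpose (cmat A)"
  by (simp_all add: vec_eq_iff cscale_def transpose_def mat_def)

lemma cmat_mult: "cmat (A ** B) = cmat A ** cmat B"
  by (simp add: vec_eq_iff matrix_matrix_mult_def)

lemma cmat_eq_iff: "cmat A = cmat B \<longleftrightarrow> A = B"
  by (simp add: vec_eq_iff)

lemma map_cnj_simps:
  fixes A B :: "complex ^ 'n ^ 'm"
  shows "map_matrix cnj (A + B) = map_matrix cnj A + map_matrix cnj B"
    "map_matrix cnj (- A) = - map_matrix cnj A"
    "map_matrix cnj (transpose A) = transpose (map_matrix cnj A)"
    "map_matrix cnj (a *c A) = cnj a *c map_matrix cnj A"
    "map_matrix cnj (cmat R) = cmat R"
    "map_matrix cnj (mat 1 :: complex ^ 'k ^ 'k) = mat 1"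
  by (simp_all add: vec_eq_iff transpose_def cscale_def mat_def)

lemma map_cnj_mult:
  fixes A :: "complex ^ 'n ^ 'm" and B :: "complex ^ 'k ^ 'n"
  shows "map_matrix cnj (A ** B) = map_matrix cnj A ** map_matrix cnj B"
  by (simp add: vec_eq_iff matrix_matrix_mult_def)

lemma matrix_inv_eqI:
  fixes A B :: "'a::field ^ 'n ^ 'n"
  assumes "A ** B = mat 1"
  shows "invertible A" "matrix_inv A = B"
proof -
  show inv: "invertible A"
    using assms invertible_right_inverse by blast
  have "B ** A = mat 1"
    using assms matrix_left_right_inverse by blast
  moreover have "A ** matrix_inv A = mat 1 \<and> matrix_inv A ** A = mat 1"
    using inv unfolding invertible_def matrix_inv_def by (rule someI_ex)
  ultimately show "matrix_inv A = B"
    by (metis matrix_mul_assoc matrix_mul_lid matrix_mul_rid)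
qed

lemma matrix_inv_mult:
  fixes A :: "'a::field ^ 'n ^ 'n"
  assumes "invertible A"
  shows "A ** matrix_inv A = mat 1" "matrix_inv A ** A = mat 1"
  using someI_ex[OF assms[unfolded invertible_def]] unfolding matrix_inv_def by auto

section \<open>Block matrices\<close>

lemma block_nth [simp]:
  "block P Q R S $ Inl a $ Inl b = P $ a $ b" "block P Q R S $ Inl a $ Inr b = Q $ a $ b"
  "block P Q R S $ Inr a $ Inl b = R $ a $ b" "block P Q R S $ Inr a $ Inr b = S $ a $ b"
  by (simp_all add: block_def)

lemma forall_sum: "(\<forall>x. P x) \<longleftrightarrow> (\<forall>a. P (Inl a)) \<and> (\<forall>b. P (Inr b))"
  by (metis sum.exhaust)

lemma block_eq_iff:
  "block P Q R S = block P' Q' R' S' \<longleftrightarrow> P = P' \<and> Q = Q' \<and> R = R' \<and> S = S'"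
  by (auto simp: vec_eq_iff forall_sum)

lemma block_exhaust: "block (blk11 M) (blk12 M) (blk21 M) (blk22 M) = M"
  by (simp add: vec_eq_iff forall_sum blk11_def blk12_def blk21_def blk22_def)

lemma blk_block [simp]:
  "blk11 (block P Q R S) = P" "blk12 (block P Q R S) = Q"
  "blk21 (block P Q R S) = R" "blk22 (block P Q R S) = S"
  by (simp_all add: vec_eq_iff blk11_def blk12_def blk21_def blk22_def)

lemma sum_UNIV_sum:
  fixes f :: "'a::finite + 'b::finite \<Rightarrow> 'c::comm_monoid_add"
  shows "sum f UNIV = (\<Sum>a\<in>UNIV. f (Inl a)) + (\<Sum>b\<in>UNIV. f (Inr b))"
  unfolding UNIV_Plus_UNIV[symmetric] by (subst sum.Plus) auto

lemma block_mult:
  fixes P :: "'a::semiring_1 ^ 'n ^ 'n"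
  shows "block P Q R S ** block P' Q' R' S' =
    block (P ** P' + Q ** R') (P ** Q' + Q ** S') (R ** P' + S ** R') (R ** Q' + S ** S')"
  by (simp add: vec_eq_iff forall_sum matrix_matrix_mult_def sum_UNIV_sum)

lemma block_simps:
  "block P Q R S + block P' Q' R' S' = block (P + P') (Q + Q') (R + R') (S + S')"
  "block P Q R S - block P' Q' R' S' = block (P - P') (Q - Q') (R - R') (S - S')"
  "- block P Q R S = block (- P) (- Q) (- R) (- S)"
  "transpose (block P Q R S) = block (transpose P) (transpose R) (transpose Q) (transpose S)"
  "block 0 0 0 0 = 0"
  "block (mat 1) 0 0 (mat 1) = mat 1"
  "map_matrix cnj (block P1 Q1 R1 S1) =
    block (map_matrix cnj P1) (map_matrix cnj Q1) (map_matrix cnj R1) (map_matrix cnj S1)"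
  "c *c block P2 Q2 R2 S2 = block (c *c P2) (c *c Q2) (c *c R2) (c *c S2)"
  for P :: "'a::ring_1 ^ 'n ^ 'n" and P1 :: "complex ^ 'n ^ 'n" and P2 :: "'b::times ^ 'n ^ 'n"
  by (simp_all add: vec_eq_iff forall_sum transpose_def mat_def cscale_def)

lemma block_eq_0_iff: "block P Q R S = 0 \<longleftrightarrow> P = 0 \<and> Q = 0 \<and> R = 0 \<and> S = 0"
  by (auto simp: vec_eq_iff forall_sum)

lemma Inn_square: "Inn ** Inn = mat 1"
  by (simp add: Inn_def block_mult matrix_distribs block_simps)

lemma matrix_inv_Inn: "matrix_inv Inn = Inn"
  by (simp add: Inn_square matrix_inv_eqI(2))

lemma Inn_conj_block:
  "Inn ** block P Q R S ** Inn = block P (- Q) (- R) S"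
  by (simp add: Inn_def block_mult matrix_distribs)

lemma Inn_conj_mult:
  "Inn ** (A ** B) ** Inn = (Inn ** A ** Inn) ** (Inn ** B ** Inn)"
  for A B :: "complex ^ ('n::finite + 'n) ^ ('n + 'n)"
proof -
  have "X ** Inn ** Inn = X" for X :: "complex ^ ('n + 'n) ^ ('n + 'n)"
    by (simp add: matrix_mul_assoc[symmetric] Inn_square)
  then show ?thesis by (simp add: matrix_mul_assoc)
qed

section \<open>The Lax connection in real form\<close>

definition dmat :: "real ^ 'n \<Rightarrow> real ^ 'n ^ 'n"
  where "dmat v = (\<chi> i j. if i = j then v $ i else 0)"

text \<open>One expression serves both diagonal blocks of the Lax connection: \<open>G = F x\<close>
  gives the upper block and \<open>G = transpose (F x)\<close> the lower one. Its values are
  skew-symmetric.\<close>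

definition conn :: "real ^ 'n ^ 'n \<Rightarrow> real ^ 'n \<Rightarrow> real ^ 'n ^ 'n"
  where "conn G v = dmat v ** transpose G - G ** dmat v"

lemma delta_eq: "delta v = cmat (dmat v)"
  by (simp add: delta_def dmat_def vec_eq_iff)

lemma theta_eq:
  "theta F \<mu> x v =
    block (cmat (conn (F x) v)) (- (\<mu> *c cmat (dmat v)))
      (\<mu> *c cmat (dmat v)) (cmat (conn (transpose (F x)) v))"
  by (simp add: theta_def Let_def delta_eq conn_def cmat_simps cmat_mult block_simps algebra_simps)

lemma dmat_mult_nth:
  "(dmat v ** G) $ i $ j = v $ i * G $ i $ j" "(G ** dmat v) $ i $ j = G $ i $ j * v $ j"
proof -
  have "(dmat v ** G) $ i $ j = (\<Sum>k\<in>UNIV. if k = i then v $ i * G $ i $ j else 0)"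
    unfolding matrix_matrix_mult_def dmat_def by (simp del: sum.delta sum.delta', intro sum.cong) auto
  then show "(dmat v ** G) $ i $ j = v $ i * G $ i $ j" by simp
  have "(G ** dmat v) $ i $ j = (\<Sum>k\<in>UNIV. if k = j then G $ i $ j * v $ j else 0)"
    unfolding matrix_matrix_mult_def dmat_def by (simp del: sum.delta sum.delta', intro sum.cong) auto
  then show "(G ** dmat v) $ i $ j = G $ i $ j * v $ j" by simp
qed

lemma dmat_commute: "dmat u ** dmat v = dmat v ** dmat u"
  by (simp add: vec_eq_iff dmat_mult_nth) (simp add: dmat_def)

lemma transpose_dmat [simp]: "transpose (dmat v) = dmat v"
  by (auto simp: vec_eq_iff dmat_def transpose_def)

lemma transpose_conn: "transpose (conn G v) = - conn G v"
  by (simp add: conn_def matrix_transpose_mul)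

text \<open>On either side the two terms with \<open>transpose G\<close> between
  \<open>dmat u\<close> and \<open>dmat v\<close> cancel. What is left involves only the product of
  the two diagonal matrices, hence is symmetric in \<open>u\<close> and \<open>v\<close>. This is
  the vanishing of the part of the curvature that is linear in the spectral parameter.\<close>

lemma conn_dmat_exchange:
  "conn G u ** dmat v + dmat u ** conn (transpose G) v =
   conn G v ** dmat u + dmat v ** conn (transpose G) u"
  by (simp add: conn_def matrix_distribs dmat_commute[of u v])
     (simp add: matrix_mul_assoc[symmetric] dmat_commute[of u v])

text \<open>The diagonal of \<open>b\<close> commutes with \<open>dmat v\<close>, so removing it does not change the commutator.\<close>

lemma conn_off_diag: "conn (off_diag b) v = conn b v"
  by (simp add: vec_eq_iff conn_def dmat_mult_nth off_diag_def transpose_def)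

lemma conn_add: "conn (G + H) v = conn G v + conn H v"
  by (simp add: conn_def matrix_distribs)

lemma conn_scaleR: "conn (r *\<^sub>R G) v = r *\<^sub>R conn G v"
  by (simp add: conn_def matrix_distribs transpose_scalar algebra_simps)

section \<open>Calculus for matrix-valued maps\<close>

lemma bounded_linear_matrix:
  fixes f :: "'a::euclidean_space \<Rightarrow> 'b::real_normed_vector"
  assumes "\<And>x y. f (x + y) = f x + f y" "\<And>r x. f (r *\<^sub>R x) = r *\<^sub>R f x"
  shows "bounded_linear f"
  unfolding linear_conv_bounded_linear[symmetric] by (intro linearI assms)

lemma bounded_bilinear_matrix_mult:
  "bounded_bilinear ((**) :: 'a::{euclidean_space, real_algebra_1} ^ 'n ^ 'm \<Rightarrow> 'a ^ 'p ^ 'n \<Rightarrow> 'a ^ 'p ^ 'm)"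
  unfolding bilinear_conv_bounded_bilinear[symmetric] bilinear_def
  by (auto intro!: linearI simp: matrix_add_ldistrib matrix_add_rdistrib matrix_scaleR_left matrix_scaleR_right)

lemma bounded_linear_transpose: "bounded_linear (transpose :: real ^ 'n ^ 'm \<Rightarrow> real ^ 'm ^ 'n)"
  by (rule bounded_linear_matrix) (simp_all add: transpose_scalar)

lemma bounded_linear_off_diag: "bounded_linear off_diag"
  by (rule bounded_linear_matrix) (simp_all add: vec_eq_iff off_diag_def)

lemma bounded_linear_conn: "bounded_linear (\<lambda>G. conn G v)"
  by (rule bounded_linear_matrix) (simp_all add: conn_add conn_scaleR)

lemma bounded_linear_map_cnj:
  "bounded_linear (map_matrix cnj :: complex ^ 'n ^ 'm \<Rightarrow> complex ^ 'n ^ 'm)"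
  by (rule bounded_linear_matrix) (simp_all add: vec_eq_iff)

lemma bounded_linear_map_Re:
  "bounded_linear (map_matrix Re :: complex ^ 'n ^ 'm \<Rightarrow> real ^ 'n ^ 'm)"
  by (rule bounded_linear_matrix) (simp_all add: vec_eq_iff)

lemma bounded_linear_map_Im:
  "bounded_linear (map_matrix Im :: complex ^ 'n ^ 'm \<Rightarrow> real ^ 'n ^ 'm)"
  by (rule bounded_linear_matrix) (simp_all add: vec_eq_iff)

lemma bounded_linear_ctranspose:
  "bounded_linear (transpose :: complex ^ 'n ^ 'm \<Rightarrow> complex ^ 'm ^ 'n)"
  by (rule bounded_linear_matrix) (simp_all add: transpose_scalar)

lemma bounded_linear_cscale: "bounded_linear (\<lambda>A :: complex ^ 'n ^ 'm. c *c A)"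
  by (rule bounded_linear_matrix) (simp_all add: vec_eq_iff cscale_def algebra_simps)

lemma bounded_linear_blk:
  "bounded_linear (blk11 :: complex ^ ('n + 'n) ^ ('n + 'n) \<Rightarrow> complex ^ 'n ^ 'n)"
  "bounded_linear (blk12 :: complex ^ ('n + 'n) ^ ('n + 'n) \<Rightarrow> complex ^ 'n ^ 'n)"
  "bounded_linear (blk21 :: complex ^ ('n + 'n) ^ ('n + 'n) \<Rightarrow> complex ^ 'n ^ 'n)"
  "bounded_linear (blk22 :: complex ^ ('n + 'n) ^ ('n + 'n) \<Rightarrow> complex ^ 'n ^ 'n)"
  by (auto intro!: bounded_linear_matrix simp: vec_eq_iff blk11_def blk12_def blk21_def blk22_def)

text \<open>
  The product rule needs only continuity of the second factor where the first factor vanishes;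
  this is how the derivative of a matrix inverse is obtained.
\<close>

lemma has_derivative_matrix_mult_zero:
  fixes A :: "'c::real_normed_vector \<Rightarrow> real ^ 'n ^ 'm" and g :: "'c \<Rightarrow> real ^ 'p ^ 'n"
  assumes A: "(A has_derivative A') (at x)" and "A x = 0" and g: "isCont g x"
  shows "((\<lambda>y. A y ** g y) has_derivative (\<lambda>h. A' h ** g x)) (at x)"
proof -
  interpret M: bounded_bilinear "(**) :: real ^ 'n ^ 'm \<Rightarrow> real ^ 'p ^ 'n \<Rightarrow> real ^ 'p ^ 'm"
    by (rule bounded_bilinear_matrix_mult)
  interpret A': bounded_linear A'
    using A by (rule has_derivative_bounded_linear)
  have lim: "((\<lambda>y. (A y - A x - A' (y - x)) /\<^sub>R norm (y - x)) \<longlongrightarrow> 0) (at x)"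
    using A by (simp add: has_derivative_at_within)
  have g': "(g \<longlongrightarrow> g x) (at x)" "((\<lambda>y. g y - g x) \<longlongrightarrow> 0) (at x)"
    using g by (simp_all add: isCont_def LIM_zero)
  \<comment> \<open>Since \<open>A x = 0\<close>, the remainder is
    \<open>(A y - A x - A' (y - x)) ** g y + A' (y - x) ** (g y - g x)\<close>. After division by
    the distance, the first summand is null times convergent, the second bounded times null.\<close>
  have t1: "((\<lambda>y. ((A y - A x - A' (y - x)) /\<^sub>R norm (y - x)) ** g y) \<longlongrightarrow> 0) (at x)"
    using M.tendsto[OF lim g'(1)] by (simp add: M.zero_left)
  obtain K where K: "\<And>h. norm (A' h) \<le> norm h * K"
    using A'.bounded by blast
  have "Bfun (\<lambda>y. A' (y - x) /\<^sub>R norm (y - x)) (at x)"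
  proof (rule BfunI[of _ K])
    show "\<forall>\<^sub>F y in at x. norm (A' (y - x) /\<^sub>R norm (y - x)) \<le> K"
      unfolding eventually_at_topological
    proof (intro exI[of _ UNIV] conjI ballI impI)
      fix y assume "y \<noteq> x"
      then show "norm (A' (y - x) /\<^sub>R norm (y - x)) \<le> K"
        using K[of "y - x"] by (simp add: divide_simps mult.commute)
    qed auto
  qed
  from M.Bfun_prod_Zfun[OF this g'(2)[unfolded tendsto_Zfun_iff diff_0_right]]
  have t2: "((\<lambda>y. (A' (y - x) /\<^sub>R norm (y - x)) ** (g y - g x)) \<longlongrightarrow> 0) (at x)"
    by (simp add: tendsto_Zfun_iff)
  have "((\<lambda>y. (A y ** g y - A x ** g x - A' (y - x) ** g x) /\<^sub>R norm (y - x)) \<longlongrightarrow> 0) (at x)"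
    using tendsto_add[OF t1 t2]
    by (rule filterlim_cong[THEN iffD1, rotated -1])
       (auto simp: \<open>A x = 0\<close> matrix_distribs algebra_simps)
  moreover have "bounded_linear (\<lambda>h. A' h ** g x)"
    by (intro M.bounded_linear_left[THEN bounded_linear_compose] A'.bounded_linear_axioms)
  ultimately show ?thesis
    by (simp add: has_derivative_at_within)
qed

section \<open>Smoothness\<close>

lemma C_k_differentiable: "C_k (Suc k) f \<Longrightarrow> (f has_derivative frechet_derivative f (at x)) (at x)"
  by (simp add: frechet_derivative_works)

lemma C_k_SucI:
  assumes "\<And>x. (f has_derivative f' x) (at x)" "\<And>i. C_k k (\<lambda>x. f' x (axis i 1))"
  shows "C_k (Suc k) f"
proof -
  have "frechet_derivative f (at x) = f' x" for x
    using frechet_derivative_at[OF assms(1)] by simp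
  with assms show ?thesis by (auto simp: differentiable_def)
qed

lemma C_k_SucD: "C_k (Suc k) f \<Longrightarrow> C_k k f"
proof (induction k arbitrary: f)
  case 0
  then show ?case
    by (auto simp: continuous_on_eq_continuous_at differentiable_imp_continuous_within)
next
  case (Suc k)
  then show ?case by (metis C_k.simps(2))
qed

lemma C_k_linear:
  assumes "bounded_linear L" "C_k k f"
  shows "C_k k (\<lambda>x. L (f x))"
  using assms(2)
proof (induction k arbitrary: f)
  case 0
  then show ?case
    using bounded_linear.continuous_on[OF assms(1)] by auto
next
  case (Suc k)
  show ?case
    by (rule C_k_SucI[OF bounded_linear.has_derivative[OF assms(1) C_k_differentiable[OF Suc.prems]]])
       (use Suc in auto)
qed

lemma C_k_const: "C_k k (\<lambda>x. c)"
proof (induction k arbitrary: c)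
  case (Suc k)
  show ?case by (rule C_k_SucI[OF has_derivative_const Suc])
qed auto

lemma C_k_add:
  assumes "C_k k f" "C_k k g"
  shows "C_k k (\<lambda>x. f x + g x)"
  using assms
proof (induction k arbitrary: f g)
  case 0
  then show ?case by (auto intro: continuous_on_add)
next
  case (Suc k)
  show ?case
    by (rule C_k_SucI[OF has_derivative_add[OF Suc.prems[THEN C_k_differentiable]]])
       (use Suc in auto)
qed

lemma C_k_diff:
  assumes "C_k k f" "C_k k g"
  shows "C_k k (\<lambda>x. f x - g x)"
  using C_k_add[OF assms(1) C_k_linear[OF bounded_linear_minus[OF bounded_linear_ident] assms(2)]]
  by simp

lemma C_k_bilinear:
  assumes "bounded_bilinear B" "C_k k f" "C_k k g"
  shows "C_k k (\<lambda>x. B (f x) (g x))"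
  using assms(2,3)
proof (induction k arbitrary: f g)
  case 0
  then show ?case
    using bounded_bilinear.continuous_on[OF assms(1)] by auto
next
  case (Suc k)
  show ?case
    by (rule C_k_SucI[OF bounded_bilinear.FDERIV[OF assms(1) Suc.prems[THEN C_k_differentiable]]])
       (use Suc in \<open>auto intro!: C_k_add Suc.IH simp: C_k_SucD[OF Suc.prems(1)] C_k_SucD[OF Suc.prems(2)]\<close>)
qed

section \<open>Limits of parallel frames\<close>

text \<open>A Gronwall estimate on a small ball. At a maximiser \<open>z\<close> of the norm, the
  mean value inequality bounds \<open>norm (h z - h y)\<close> by
  \<open>2 * r * (a * norm (h z) + c)\<close>; the condition \<open>4 * r * a \<le> 1\<close> lets
  half of \<open>norm (h z)\<close> be absorbed on the left.\<close>

lemma sup_bound_on_cball: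
  fixes h :: "'a::euclidean_space \<Rightarrow> 'b::real_normed_vector" and h' :: "'a \<Rightarrow> 'a \<Rightarrow> 'b"
  assumes h: "\<And>x. x \<in> cball x0 r \<Longrightarrow> (h has_derivative h' x) (at x)"
    and h': "\<And>x v. x \<in> cball x0 r \<Longrightarrow> norm (h' x v) \<le> (a * norm (h x) + c) * norm v"
    and "0 \<le> a" "0 \<le> c" "4 * r * a \<le> 1" "x \<in> cball x0 r" "y \<in> cball x0 r"
  shows "norm (h x) \<le> 2 * norm (h y) + 4 * r * c"
proof -
  have cont: "continuous_on (cball x0 r) (\<lambda>x. norm (h x))"
    by (intro continuous_on_norm continuous_at_imp_continuous_on ballI has_derivative_continuous[OF h])
  obtain z where z: "z \<in> cball x0 r" "\<And>w. w \<in> cball x0 r \<Longrightarrow> norm (h w) \<le> norm (h z)"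
    using continuous_attains_sup[OF compact_cball _ cont] assms(6) by (metis empty_iff)
  have "0 \<le> r" using assms(6) by (meson dist_not_less_zero mem_cball not_le order_trans)
  define B where "B = a * norm (h z) + c"
  have B: "0 \<le> B" using assms(3,4) by (simp add: B_def)
  have "norm (h z - h y) \<le> B * norm (z - y)"
  proof (rule differentiable_bound[OF convex_cball _ _ z(1) assms(7)])
    fix w assume w: "w \<in> cball x0 r"
    then show "(h has_derivative h' w) (at w within cball x0 r)"
      by (simp add: h has_derivative_at_withinI)
    show "onorm (h' w) \<le> B"
    proof (rule onorm_le)
      fix v :: 'a
      have "(a * norm (h w) + c) * norm v \<le> B * norm v"
        using z(2)[OF w] assms(3) by (auto simp: B_def intro!: mult_right_mono mult_left_mono)
      with h'[OF w, of v] show "norm (h' w v) \<le> B * norm v" by linarith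
    qed
  qed
  also have "norm (z - y) \<le> 2 * r"
    using dist_triangle2[of z y x0] z(1) assms(7) by (simp add: dist_norm norm_minus_commute)
  then have "B * norm (z - y) \<le> B * (2 * r)" using B by (rule mult_left_mono)
  also have "B * (2 * r) = (4 * r * a) * (norm (h z) / 2) + 2 * r * c"
    by (simp add: B_def algebra_simps)
  also have "\<dots> \<le> 1 * (norm (h z) / 2) + 2 * r * c"
    using assms(5) by (intro add_right_mono mult_right_mono) auto
  finally have "norm (h z) \<le> 2 * norm (h y) + 4 * r * c"
    using norm_triangle_ineq2[of "h z" "h y"] by simp
  with z(2)[OF assms(6)] show ?thesis by linarith
qed

text \<open>The Gronwall estimate is used twice: for \<open>g k\<close> it yields a uniform bound,
  and for \<open>g k - g l\<close>, which satisfies the same equation up to an error of size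
  \<open>\<epsilon> k + \<epsilon> l\<close>, it yields a uniform Cauchy property. The derivatives
  then converge uniformly too. The radius depends only on the limit form near \<open>x0\<close>, not
  on the point \<open>y\<close> at which convergence is known; this is what makes the statement
  propagate.\<close>

lemma local_limit_of_parallel:
  fixes g :: "nat \<Rightarrow> real ^ 'n \<Rightarrow> complex ^ 'm ^ 'm"
    and \<omega>' :: "real ^ 'n \<Rightarrow> real ^ 'n \<Rightarrow> complex ^ 'm ^ 'm"
  assumes g: "\<And>k x. (g k has_derivative (\<lambda>v. g k x ** \<omega> k x v)) (at x)"
    and \<omega>: "\<And>k x v. norm (\<omega> k x v - \<omega>' x v) \<le> \<epsilon> k * norm v"
    and \<epsilon>: "\<epsilon> \<longlonglongrightarrow> 0"
    and bound: "\<And>x0. \<exists>r>0. \<exists>C. \<forall>x\<in>cball x0 r. \<forall>v. norm (\<omega>' x v) \<le> C * norm v"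
  obtains r where "r > 0"
    "\<And>y. y \<in> cball x0 r \<Longrightarrow> convergent (\<lambda>k. g k y) \<Longrightarrow>
      (\<forall>x\<in>cball x0 r. convergent (\<lambda>k. g k x)) \<and>
      ((\<lambda>x. lim (\<lambda>k. g k x)) has_derivative (\<lambda>v. lim (\<lambda>k. g k x0) ** \<omega>' x0 v)) (at x0)"
proof -
  interpret M: bounded_bilinear "(**) :: complex ^ 'm ^ 'm \<Rightarrow> complex ^ 'm ^ 'm \<Rightarrow> complex ^ 'm ^ 'm"
    by (rule bounded_bilinear_matrix_mult)
  obtain K where K: "K > 0" "\<And>(A :: complex ^ 'm ^ 'm) (B :: complex ^ 'm ^ 'm). norm (A ** B) \<le> norm A * norm B * K"
    using M.pos_bounded by blast
  obtain r0 C where r0: "r0 > 0" and C: "\<And>x v. x \<in> cball x0 r0 \<Longrightarrow> norm (\<omega>' x v) \<le> C * norm v"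
    using bound[of x0] by blast
  \<comment> \<open>A coordinate vector has norm 1, so the bound tested on it compares
    \<open>\<epsilon> k\<close> itself with a norm.\<close>
  have \<epsilon>0: "0 \<le> \<epsilon> k" for k
    using order_trans[OF norm_ge_zero \<omega>[of k undefined "axis undefined 1"]] by simp
  obtain N0 where N0: "\<And>k. k \<ge> N0 \<Longrightarrow> \<epsilon> k \<le> 1"
    using order_tendstoD(2)[OF \<epsilon>, of 1] unfolding eventually_sequentially by (meson less_imp_le zero_less_one)
  \<comment> \<open>The extra 1 absorbs the deviation of \<open>\<omega> k\<close> from the limit
    form, which is at most 1 from \<open>N0\<close> on. This also keeps \<open>a\<close> positive,
    so that \<open>r\<close> can be defined by division.\<close>
  define C' where "C' = \<bar>C\<bar> + 1"
  define a where "a = K * C'"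
  have "C' > 0" by (simp add: C'_def)
  then have "a > 0" using K(1) by (simp add: a_def)
  define r where "r = min r0 (1 / (4 * a))"
  have r: "r > 0" "r \<le> r0" "4 * r * a \<le> 1"
    using r0 \<open>a > 0\<close> by (auto simp: r_def min_def field_simps)
  have \<omega>k: "norm (\<omega> k x v) \<le> C' * norm v" if "k \<ge> N0" "x \<in> cball x0 r" for k x v
  proof -
    have "norm (\<omega> k x v) \<le> norm (\<omega>' x v) + norm (\<omega> k x v - \<omega>' x v)"
      by (metis add.commute diff_add_cancel norm_triangle_ineq)
    also have "\<dots> \<le> C * norm v + \<epsilon> k * norm v"
      using C[of x v] \<omega>[of k x v] that r(2) by (intro add_mono) auto
    also have "\<dots> \<le> \<bar>C\<bar> * norm v + 1 * norm v"
      using N0[OF that(1)] by (intro add_mono mult_right_mono) auto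
    finally show ?thesis by (simp add: C'_def algebra_simps)
  qed
  have main: "(\<forall>x\<in>cball x0 r. convergent (\<lambda>k. g k x)) \<and>
      ((\<lambda>x. lim (\<lambda>k. g k x)) has_derivative (\<lambda>v. lim (\<lambda>k. g k x0) ** \<omega>' x0 v)) (at x0)"
    if y: "y \<in> cball x0 r" and conv: "convergent (\<lambda>k. g k y)" for y
  proof -
    obtain G0 where G0: "\<And>k. norm (g k y) \<le> G0"
      using convergent_imp_Bseq[OF conv] unfolding Bseq_def by blast
    define G where "G = 2 * G0"
    have G: "norm (g k x) \<le> G" if "k \<ge> N0" "x \<in> cball x0 r" for k x
    proof -
      have "norm (g k x) \<le> 2 * norm (g k y) + 4 * r * 0"
      proof (rule sup_bound_on_cball[OF g, where a = a])
        fix x v assume "x \<in> cball x0 r"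
        have "norm (g k x ** \<omega> k x v) \<le> norm (g k x) * norm (\<omega> k x v) * K"
          by (rule K(2))
        also have "\<dots> \<le> norm (g k x) * (C' * norm v) * K"
          using K(1) \<omega>k[OF that(1) \<open>x \<in> cball x0 r\<close>] by (intro mult_right_mono mult_left_mono) auto
        finally show "norm (g k x ** \<omega> k x v) \<le> (a * norm (g k x) + 0) * norm v"
          by (simp add: a_def algebra_simps)
      qed (use that y r \<open>a > 0\<close> in auto)
      also have "\<dots> \<le> G" using G0[of k] by (simp add: G_def)
      finally show ?thesis .
    qed
    have "0 \<le> G" using G[OF le_refl y] norm_ge_zero order_trans by blast
    have diff: "norm (g k x - g l x) \<le> 2 * norm (g k y - g l y) + 4 * r * (K * G * (\<epsilon> k + \<epsilon> l))"
      if k: "k \<ge> N0" and l: "l \<ge> N0" and x: "x \<in> cball x0 r" for k l x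
    proof (rule sup_bound_on_cball[where h = "\<lambda>x. g k x - g l x" and a = a, OF has_derivative_diff[OF g g]])
      fix x v assume x: "x \<in> cball x0 r"
      have "norm (g k x ** \<omega> k x v - g l x ** \<omega> l x v) =
          norm ((g k x - g l x) ** \<omega> k x v + g l x ** (\<omega> k x v - \<omega> l x v))"
        by (simp add: matrix_distribs)
      also have "\<dots> \<le> norm (g k x - g l x) * norm (\<omega> k x v) * K + norm (g l x) * norm (\<omega> k x v - \<omega> l x v) * K"
        by (intro norm_triangle_mono K(2))
      also have "\<dots> \<le> norm (g k x - g l x) * (C' * norm v) * K + G * ((\<epsilon> k + \<epsilon> l) * norm v) * K"
      proof (intro add_mono mult_right_mono mult_mono order_refl)
        have "norm (\<omega> k x v - \<omega> l x v) \<le> norm (\<omega> k x v - \<omega>' x v) + norm (\<omega> l x v - \<omega>' x v)"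
          using norm_triangle_ineq4[of "\<omega> k x v - \<omega>' x v" "\<omega> l x v - \<omega>' x v"] by simp
        with \<omega>[of k x v] \<omega>[of l x v] show "norm (\<omega> k x v - \<omega> l x v) \<le> (\<epsilon> k + \<epsilon> l) * norm v"
          by (simp add: algebra_simps)
      qed (use \<omega>k[OF k x] G[OF l x] K(1) \<open>0 \<le> G\<close> in auto)
      finally show "norm (g k x ** \<omega> k x v - g l x ** \<omega> l x v)
          \<le> (a * norm (g k x - g l x) + K * G * (\<epsilon> k + \<epsilon> l)) * norm v"
        by (simp add: a_def algebra_simps)
    qed (use x y r \<open>a > 0\<close> K(1) \<open>0 \<le> G\<close> \<epsilon>0 in auto)
    have small: "\<exists>N\<ge>N0. \<forall>k\<ge>N. \<forall>l\<ge>N. \<forall>x\<in>cball x0 r. norm (g k x - g l x) \<le> e" if "e > 0" for e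
    proof -
      define c where "c = 4 * r * (K * G)"
      have "c \<ge> 0" using r K(1) \<open>0 \<le> G\<close> by (simp add: c_def)
      have "Cauchy (\<lambda>k. g k y)" using conv by (simp add: Cauchy_convergent_iff)
      from CauchyD[OF this, of "e / 4"] that
      have "\<exists>M. \<forall>k\<ge>M. \<forall>l\<ge>M. norm (g k y - g l y) < e / 4" by simp
      then obtain N1 where N1: "\<And>k l. k \<ge> N1 \<Longrightarrow> l \<ge> N1 \<Longrightarrow> norm (g k y - g l y) < e / 4"
        by blast
      have "0 < e / (4 * (c + 1))" using that \<open>c \<ge> 0\<close> by simp
      from order_tendstoD(2)[OF \<epsilon> this]
      obtain N2 where N2: "\<And>k. k \<ge> N2 \<Longrightarrow> \<epsilon> k < e / (4 * (c + 1))"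
        unfolding eventually_sequentially by blast
      show ?thesis
      proof (intro exI[of _ "max N0 (max N1 N2)"] conjI allI impI ballI)
        fix k l x assume k: "max N0 (max N1 N2) \<le> k" and l: "max N0 (max N1 N2) \<le> l" and x: "x \<in> cball x0 r"
        have "c * (\<epsilon> k + \<epsilon> l) \<le> c * (e / (4 * (c + 1)) + e / (4 * (c + 1)))"
          using N2[of k] N2[of l] k l \<open>c \<ge> 0\<close> by (intro mult_left_mono add_mono) auto
        also have "\<dots> = c / (c + 1) * (e / 2)"
        proof -
          have "c * (e / (4 * d) + e / (4 * d)) = c / d * (e / 2)" for d :: real by simp
          then show ?thesis .
        qed
        also have "\<dots> \<le> 1 * (e / 2)"
          using \<open>c \<ge> 0\<close> that by (intro mult_right_mono) simp_all
        finally have "c * (\<epsilon> k + \<epsilon> l) \<le> e / 2" by simp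
        moreover have "norm (g k x - g l x) \<le> 2 * norm (g k y - g l y) + c * (\<epsilon> k + \<epsilon> l)"
          using diff[of k l x] k l x by (simp only: c_def mult.assoc max.bounded_iff)
        moreover have "norm (g k y - g l y) < e / 4"
          using N1 k l by simp
        ultimately show "norm (g k x - g l x) \<le> e" by linarith
      qed simp
    qed
    have conv': "convergent (\<lambda>k. g k x)" if "x \<in> cball x0 r" for x
      unfolding Cauchy_convergent_iff[symmetric] Cauchy_iff
    proof (intro allI impI)
      fix e :: real assume "e > 0"
      then obtain N where N: "\<And>k l x. k \<ge> N \<Longrightarrow> l \<ge> N \<Longrightarrow> x \<in> cball x0 r \<Longrightarrow> norm (g k x - g l x) \<le> e / 2"
        using small[of "e / 2"] by (metis half_gt_zero)
      have "norm (g k x - g l x) < e" if "k \<ge> N" "l \<ge> N" for k l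
        using N[OF that \<open>x \<in> cball x0 r\<close>] \<open>e > 0\<close> by linarith
      then show "\<exists>N. \<forall>k\<ge>N. \<forall>l\<ge>N. norm (g k x - g l x) < e" by blast
    qed
    define h where "h = (\<lambda>x. lim (\<lambda>k. g k x))"
    have h: "(\<lambda>k. g k x) \<longlonglongrightarrow> h x" if "x \<in> cball x0 r" for x
      using conv'[OF that] by (simp add: h_def convergent_LIMSEQ_iff)
    have unif: "\<exists>N\<ge>N0. \<forall>k\<ge>N. \<forall>x\<in>cball x0 r. norm (g k x - h x) \<le> e" if "e > 0" for e
    proof -
      obtain N where N: "N \<ge> N0" "\<And>k l x. k \<ge> N \<Longrightarrow> l \<ge> N \<Longrightarrow> x \<in> cball x0 r \<Longrightarrow> norm (g k x - g l x) \<le> e"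
        using small[OF \<open>e > 0\<close>] by blast
      have "norm (g k x - h x) \<le> e" if "k \<ge> N" "x \<in> cball x0 r" for k x
        by (rule Lim_bounded[OF tendsto_norm[OF tendsto_diff[OF tendsto_const h[OF that(2)]]], of N])
           (use N that in auto)
      then show ?thesis using N(1) by blast
    qed
    have x0: "x0 \<in> cball x0 r" using r by simp
    have "\<exists>g'. \<forall>x\<in>cball x0 r. (\<lambda>k. g k x) \<longlonglongrightarrow> g' x \<and>
        (g' has_derivative (\<lambda>v. h x ** \<omega>' x v)) (at x within cball x0 r)"
    proof (rule has_derivative_sequence[OF convex_cball has_derivative_at_withinI[OF g] _ x0 h[OF x0]])
      fix e :: real assume "e > 0"
      define \<eta> where "\<eta> = e / (2 * (K * C'))"
      have "\<eta> > 0" using \<open>e > 0\<close> K(1) \<open>C' > 0\<close> by (simp add: \<eta>_def)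
      then obtain N where N: "N \<ge> N0" "\<And>k x. k \<ge> N \<Longrightarrow> x \<in> cball x0 r \<Longrightarrow> norm (g k x - h x) \<le> \<eta>"
        using unif by blast
      \<comment> \<open>\<open>G\<close> may be zero; \<open>G + 1\<close> is a bound that can
        safely stand in a denominator.\<close>
      have "0 < e / (2 * (K * (G + 1)))" using \<open>e > 0\<close> K(1) \<open>0 \<le> G\<close> by simp
      from order_tendstoD(2)[OF \<epsilon> this]
      obtain N2 where N2: "\<And>k. k \<ge> N2 \<Longrightarrow> \<epsilon> k < e / (2 * (K * (G + 1)))"
        unfolding eventually_sequentially by blast
      show "\<forall>\<^sub>F k in sequentially. \<forall>x\<in>cball x0 r. \<forall>v.
          norm (g k x ** \<omega> k x v - h x ** \<omega>' x v) \<le> e * norm v"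
        unfolding eventually_sequentially
      proof (intro exI[of _ "max N N2"] allI impI ballI)
        fix k x v assume k: "max N N2 \<le> k" and x: "x \<in> cball x0 r"
        have "norm (h x) \<le> G"
          by (rule Lim_bounded[OF tendsto_norm[OF h[OF x]], of N0]) (use G x in auto)
        have "norm (g k x ** \<omega> k x v - h x ** \<omega>' x v) =
            norm ((g k x - h x) ** \<omega> k x v + h x ** (\<omega> k x v - \<omega>' x v))"
          by (simp add: matrix_distribs)
        also have "\<dots> \<le> norm (g k x - h x) * norm (\<omega> k x v) * K + norm (h x) * norm (\<omega> k x v - \<omega>' x v) * K"
          by (intro norm_triangle_mono K(2))
        also have "\<dots> \<le> \<eta> * (C' * norm v) * K + (G + 1) * ((e / (2 * (K * (G + 1)))) * norm v) * K"
        proof (intro add_mono mult_right_mono mult_mono order_refl)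
          have "\<epsilon> k * norm v \<le> (e / (2 * (K * (G + 1)))) * norm v"
            using N2[of k] k by (intro mult_right_mono) auto
          with \<omega>[of k x v] show "norm (\<omega> k x v - \<omega>' x v) \<le> (e / (2 * (K * (G + 1)))) * norm v"
            by linarith
        qed (use \<omega>k[of k x v] N k x K(1) \<open>0 \<le> G\<close> \<open>\<eta> > 0\<close> \<open>norm (h x) \<le> G\<close> in auto)
        also have "\<dots> = e * norm v"
        proof -
          have "p * (q / (2 * (K * p)) * t) * K = q * t / 2" if "p > 0" for p q t :: real
            using that K(1) by simp
          from this[of "G + 1" e "norm v"] have "(G + 1) * (e / (2 * (K * (G + 1))) * norm v) * K = e * norm v / 2"
            using \<open>0 \<le> G\<close> by simp
          moreover have "\<eta> * (C' * norm v) * K = e * norm v / 2"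
            using K(1) \<open>C' > 0\<close> by (simp add: \<eta>_def)
          ultimately show ?thesis by (simp only: field_sum_of_halves)
        qed
        finally show "norm (g k x ** \<omega> k x v - h x ** \<omega>' x v) \<le> e * norm v" .
      qed
    qed
    then obtain g' where g': "\<And>x. x \<in> cball x0 r \<Longrightarrow> (\<lambda>k. g k x) \<longlonglongrightarrow> g' x"
      "(g' has_derivative (\<lambda>v. h x0 ** \<omega>' x0 v)) (at x0 within cball x0 r)"
      using x0 by blast
    have "g' x = h x" if "x \<in> cball x0 r" for x
      using g'(1)[OF that] h[OF that] LIMSEQ_unique by blast
    then have "(h has_derivative (\<lambda>v. h x0 ** \<omega>' x0 v)) (at x0 within cball x0 r)"
      by (intro has_derivative_transform[OF x0 _ g'(2)]) simp
    moreover have "at x0 within cball x0 r = at x0"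
      using r(1) by (intro at_within_interior) simp
    ultimately have "(h has_derivative (\<lambda>v. h x0 ** \<omega>' x0 v)) (at x0)" by simp
    then show ?thesis using conv' by (simp add: h_def)
  qed
  then show thesis using that[OF r(1)] by blast
qed

text \<open>Around each point there is a ball on which convergence at one point is equivalent to
  convergence at every point. The set of convergence is therefore open and closed, and connectedness
  of the space makes it everything.\<close>

lemma limit_of_parallel:
  fixes g :: "nat \<Rightarrow> real ^ 'n \<Rightarrow> complex ^ 'm ^ 'm"
    and \<omega>' :: "real ^ 'n \<Rightarrow> real ^ 'n \<Rightarrow> complex ^ 'm ^ 'm"
  assumes g: "\<And>k x. (g k has_derivative (\<lambda>v. g k x ** \<omega> k x v)) (at x)"
    and \<omega>: "\<And>k x v. norm (\<omega> k x v - \<omega>' x v) \<le> \<epsilon> k * norm v"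
    and \<epsilon>: "\<epsilon> \<longlonglongrightarrow> 0"
    and bound: "\<And>x0. \<exists>r>0. \<exists>C. \<forall>x\<in>cball x0 r. \<forall>v. norm (\<omega>' x v) \<le> C * norm v"
    and conv: "convergent (\<lambda>k. g k z)"
  shows "convergent (\<lambda>k. g k x)"
    "((\<lambda>x. lim (\<lambda>k. g k x)) has_derivative (\<lambda>v. lim (\<lambda>k. g k x) ** \<omega>' x v)) (at x)"
proof -
  note loc = local_limit_of_parallel[OF g \<omega> \<epsilon> bound]
  have all: "convergent (\<lambda>k. g k x)" for x
  proof (rule connected_induction_simple[OF connected_UNIV, where P = "\<lambda>x. convergent (\<lambda>k. g k x)"])
    fix a :: "real ^ 'n"
    show "\<exists>T. openin (top_of_set UNIV) T \<and> a \<in> T \<and>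
        (\<forall>x\<in>T. \<forall>y\<in>T. convergent (\<lambda>k. g k x) \<longrightarrow> convergent (\<lambda>k. g k y))"
    proof (rule loc[of a])
      fix r :: real
      assume "r > 0" and r: "\<And>y. y \<in> cball a r \<Longrightarrow> convergent (\<lambda>k. g k y) \<Longrightarrow>
        (\<forall>x\<in>cball a r. convergent (\<lambda>k. g k x)) \<and>
        ((\<lambda>x. lim (\<lambda>k. g k x)) has_derivative (\<lambda>v. lim (\<lambda>k. g k a) ** \<omega>' a v)) (at a)"
      have "convergent (\<lambda>k. g k y)" if "x \<in> ball a r" "y \<in> ball a r" "convergent (\<lambda>k. g k x)" for x y
        using r[of x] that by auto
      then have "\<forall>x\<in>ball a r. \<forall>y\<in>ball a r. convergent (\<lambda>k. g k x) \<longrightarrow> convergent (\<lambda>k. g k y)"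
        by blast
      moreover have "openin (top_of_set UNIV) (ball a r)" "a \<in> ball a r"
        using \<open>r > 0\<close> by simp_all
      ultimately show ?thesis by blast
    qed
  qed (use conv in auto)
  show "convergent (\<lambda>k. g k x)" by (rule all)
  show "((\<lambda>x. lim (\<lambda>k. g k x)) has_derivative (\<lambda>v. lim (\<lambda>k. g k x) ** \<omega>' x v)) (at x)"
  proof (rule loc[of x])
    fix r :: real
    assume "r > 0" and r: "\<And>y. y \<in> cball x r \<Longrightarrow> convergent (\<lambda>k. g k y) \<Longrightarrow>
      (\<forall>x\<in>cball x r. convergent (\<lambda>k. g k x)) \<and>
      ((\<lambda>x. lim (\<lambda>k. g k x)) has_derivative (\<lambda>v. lim (\<lambda>k. g k x) ** \<omega>' x v)) (at x)"
    then show ?thesis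
      using r[OF _ all, of x] by simp
  qed
qed

section \<open>Flatness\<close>

text \<open>Here \<open>H\<close> is the derivative of the map whose value is \<open>G\<close>.\<close>

definition curv ::
  "real ^ 'n ^ 'n \<Rightarrow> (real ^ 'n \<Rightarrow> real ^ 'n ^ 'n) \<Rightarrow> real ^ 'n \<Rightarrow> real ^ 'n \<Rightarrow> real ^ 'n ^ 'n"
  where "curv G H u v =
    conn (H u) v - conn (H v) u + (conn G u ** conn G v - conn G v ** conn G u)"

lemma has_derivative_theta:
  assumes "(F has_derivative F') (at x)"
  shows "((\<lambda>x. theta F \<mu> x v) has_derivative
    (\<lambda>u. block (cmat (conn (F' u) v)) 0 0 (cmat (conn (transpose (F' u)) v)))) (at x)"
proof -
  have "bounded_linear (\<lambda>G. block (cmat (conn G v)) 0 0 (cmat (conn (transpose G) v)))"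
    by (rule bounded_linear_matrix)
       (simp_all add: vec_eq_iff forall_sum conn_add conn_scaleR transpose_scalar
         scaleR_conv_of_real[where 'a = complex])
  from has_derivative_add[OF bounded_linear.has_derivative[OF this assms]
      has_derivative_const[of "block 0 (- (\<mu> *c cmat (dmat v))) (\<mu> *c cmat (dmat v)) 0"]]
  show ?thesis by (simp add: theta_eq block_simps)
qed

text \<open>The right-hand side is free of \<open>\<mu>\<close>. In the wedge product the terms
  linear in \<open>\<mu>\<close> cancel by \<open>conn_dmat_exchange\<close>, the quadratic ones
  because diagonal matrices commute, and the exterior derivative does not see the constant term
  carrying \<open>\<mu>\<close>. Flatness at any one parameter is thus flatness at all of
  them.\<close>

lemma flat_theta_iff:
  assumes F: "\<And>x. (F has_derivative F' x) (at x)"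
  shows "flat (theta F \<mu>) \<longleftrightarrow>
    (\<forall>x u v. curv (F x) (F' x) u v = 0 \<and> curv (transpose (F x)) (\<lambda>v. transpose (F' x v)) u v = 0)"
proof -
  have ed: "ext_deriv (theta F \<mu>) x u v =
      block (cmat (conn (F' x u) v - conn (F' x v) u)) 0 0
        (cmat (conn (transpose (F' x u)) v - conn (transpose (F' x v)) u))" for x u v
  proof -
    have "frechet_derivative (\<lambda>y. theta F \<mu> y v) (at x) =
        (\<lambda>u. block (cmat (conn (F' x u) v)) 0 0 (cmat (conn (transpose (F' x u)) v)))" for x v
      by (rule frechet_derivative_at[OF has_derivative_theta[OF F], symmetric])
    then show ?thesis by (simp add: ext_deriv_def block_simps cmat_simps)
  qed
  have wd: "wedge (theta F \<mu>) (theta F \<mu>) x u v =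
      block (cmat (conn (F x) u ** conn (F x) v - conn (F x) v ** conn (F x) u)) 0 0
        (cmat (conn (transpose (F x)) u ** conn (transpose (F x)) v
             - conn (transpose (F x)) v ** conn (transpose (F x)) u))" for x u v
  proof -
    let ?D = "\<lambda>u. cmat (dmat u)" and ?A = "\<lambda>u. cmat (conn (F x) u)"
      and ?B = "\<lambda>u. cmat (conn (transpose (F x)) u)"
    have "?A u ** ?D v + ?D u ** ?B v = ?A v ** ?D u + ?D v ** ?B u"
      "?B u ** ?D v + ?D u ** ?A v = ?B v ** ?D u + ?D v ** ?A u"
      using conn_dmat_exchange[of "F x" u v] conn_dmat_exchange[of "transpose (F x)" u v]
      by (simp_all add: cmat_mult[symmetric] cmat_simps(1)[symmetric])
    then have "\<mu> *c (?A u ** ?D v) + \<mu> *c (?D u ** ?B v) = \<mu> *c (?A v ** ?D u) + \<mu> *c (?D v ** ?B u)"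
      "\<mu> *c (?B u ** ?D v) + \<mu> *c (?D u ** ?A v) = \<mu> *c (?B v ** ?D u) + \<mu> *c (?D v ** ?A u)"
      by (simp_all add: cscale_distribs[symmetric])
    moreover have "?D u ** ?D v = ?D v ** ?D u"
      by (simp add: cmat_mult[symmetric] dmat_commute)
    ultimately show ?thesis
      unfolding wedge_def theta_eq block_mult block_simps block_eq_iff
      by (simp add: matrix_distribs cmat_simps cmat_mult) (simp add: algebra_simps)
  qed
  show ?thesis
    unfolding flat_def ed wd block_simps block_eq_0_iff
    by (simp add: curv_def cmat_simps(1)[symmetric] cmat_eq_iff[of _ 0, unfolded cmat_simps(4)])
qed

text \<open>The Riccati system contracted with the tangent vector \<open>v\<close>, written through
  \<open>conn\<close>; \<open>dressing_deriv_eq_sum\<close> recovers the coordinate form.\<close>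

definition dressing_deriv ::
  "real \<Rightarrow> real ^ 'n ^ 'n \<Rightarrow> real ^ 'n ^ 'n \<Rightarrow> real ^ 'n \<Rightarrow> real ^ 'n ^ 'n"
  where "dressing_deriv s G b v =
    b ** conn G v - conn (transpose G) v ** b - s *\<^sub>R dmat v + s *\<^sub>R (b ** dmat v ** b)"

text \<open>The Riccati system is invariant under transposing \<open>G\<close> and \<open>b\<close>
  together. This symmetry reduces the second curvature identity of the new solution to the
  first.\<close>

lemma transpose_dressing_deriv:
  "transpose (dressing_deriv s G b v) = dressing_deriv s (transpose G) (transpose b) v"
  by (simp add: dressing_deriv_def matrix_transpose_mul transpose_conn transpose_scalar matrix_distribs)

lemma transpose_off_diag: "transpose (off_diag b) = off_diag (transpose b)"
  by (auto simp: vec_eq_iff transpose_def off_diag_def)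

text \<open>The curvature is a polynomial in \<open>s\<close>. Order zero is the assumed identity
  for \<open>transpose G\<close>. At order one, the commutators of \<open>B\<close> with
  \<open>conn b\<close> meet the terms of the Riccati derivative, and the rest cancels by the
  exchange relations \<open>e1\<close> and \<open>e2\<close>. At order two, orthogonality reduces
  \<open>dmat u ** t ** b ** dmat v\<close> to a product of diagonal matrices, and everything else
  cancels in pairs.\<close>

lemma curv_dressed:
  fixes b G :: "real ^ 'n ^ 'n"
  assumes b: "b ** transpose b = mat 1" "transpose b ** b = mat 1"
    and flat: "curv (transpose G) (\<lambda>v. transpose (H v)) u v = 0"
  shows "curv (transpose G + s *\<^sub>R off_diag b)
    (\<lambda>v. transpose (H v) + s *\<^sub>R off_diag (dressing_deriv s G b v)) u v = 0"
proof -
  define A where "A = conn G"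
  define B where "B = conn (transpose G)"
  define t where "t = transpose b"
  note D = dmat_commute[of v u]
  have D': "X ** dmat v ** dmat u = X ** dmat u ** dmat v" for X :: "real ^ 'n ^ 'n"
    using D by (simp add: matrix_mul_assoc[symmetric])
  have tb: "X ** t ** b = X" for X
    using b by (simp add: matrix_mul_assoc[symmetric] t_def)
  have "A u ** dmat v + dmat u ** B v = A v ** dmat u + dmat v ** B u"
    unfolding A_def B_def by (rule conn_dmat_exchange)
  then have "b ** (A u ** dmat v + dmat u ** B v) = b ** (A v ** dmat u + dmat v ** B u)"
    by simp
  then have e1: "b ** A u ** dmat v = b ** A v ** dmat u + b ** dmat v ** B u - b ** dmat u ** B v"
    by (simp add: matrix_distribs algebra_simps)
  have "B u ** dmat v + dmat u ** A v = B v ** dmat u + dmat v ** A u"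
    using conn_dmat_exchange[of "transpose G"] by (simp add: A_def B_def)
  then have "(B u ** dmat v + dmat u ** A v) ** t = (B v ** dmat u + dmat v ** A u) ** t"
    by simp
  then have e2: "B u ** dmat v ** t = B v ** dmat u ** t + dmat v ** A u ** t - dmat u ** A v ** t"
    by (simp add: matrix_distribs algebra_simps)
  have c: "conn (transpose (H u)) v = conn (transpose (H v)) u - (B u ** B v - B v ** B u)"
    using flat by (simp add: curv_def B_def algebra_simps)
  have cb: "conn b w = dmat w ** t - b ** dmat w" for w
    by (simp add: conn_def t_def)
  have cd: "conn (dressing_deriv s G b w) w' =
      dmat w' ** (t ** B w - A w ** t - s *\<^sub>R dmat w + s *\<^sub>R (t ** dmat w ** t))
      - (b ** A w - B w ** b - s *\<^sub>R dmat w + s *\<^sub>R (b ** dmat w ** b)) ** dmat w'" for w w'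
    by (simp add: conn_def[of "dressing_deriv s G b w"] transpose_dressing_deriv)
       (simp add: dressing_deriv_def A_def B_def t_def)
  show ?thesis
    unfolding curv_def conn_add conn_scaleR conn_off_diag cd cb B_def[symmetric] c
    by (simp add: matrix_distribs D D' tb e1 e2 scaleR_right_distrib scaleR_right_diff_distrib)
qed

section \<open>Frames\<close>

lemma is_frameD:
  assumes "is_frame F E"
  shows "((\<lambda>x. E x \<mu>) has_derivative (\<lambda>v. E x \<mu> ** theta F \<mu> x v)) (at x)"
    "map_matrix cnj (E x (cnj \<mu>)) = E x \<mu>"
    "Inn ** E x \<mu> ** Inn = E x (- \<mu>)"
    "E x \<mu> ** transpose (E x \<mu>) = mat 1"
proof -
  have inv: "invertible (E x \<mu>)" and diff: "(\<lambda>x. E x \<mu>) differentiable (at x)"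
    and eq: "\<And>v. matrix_inv (E x \<mu>) ** frechet_derivative (\<lambda>x. E x \<mu>) (at x) v = theta F \<mu> x v"
    using assms by (auto simp: is_frame_def trivialization_def)
  have "E x \<mu> ** theta F \<mu> x v = frechet_derivative (\<lambda>x. E x \<mu>) (at x) v" for v
    by (simp add: eq[symmetric] matrix_mul_assoc matrix_inv_mult[OF inv])
  then show "((\<lambda>x. E x \<mu>) has_derivative (\<lambda>v. E x \<mu> ** theta F \<mu> x v)) (at x)"
    using diff by (simp add: frechet_derivative_works)
qed (use assms in \<open>auto simp: is_frame_def reality_condition_def matrix_inv_Inn\<close>)

lemma is_frameI:
  assumes "\<And>x \<mu>. ((\<lambda>x. E x \<mu>) has_derivative (\<lambda>v. E x \<mu> ** theta F \<mu> x v)) (at x)"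
    and "\<And>x \<mu>. map_matrix cnj (E x (cnj \<mu>)) = E x \<mu>"
    and "\<And>x \<mu>. Inn ** E x \<mu> ** Inn = E x (- \<mu>)"
    and orth: "\<And>x \<mu>. E x \<mu> ** transpose (E x \<mu>) = mat 1"
  shows "is_frame F E"
proof -
  have "matrix_inv (E x \<mu>) ** (E x \<mu> ** A) = A" for x \<mu> and A :: "complex ^ ('a + 'a) ^ ('a + 'a)"
    by (simp add: matrix_mul_assoc matrix_inv_mult matrix_inv_eqI(1)[OF orth])
  moreover have "frechet_derivative (\<lambda>x. E x \<mu>) (at x) = (\<lambda>v. E x \<mu> ** theta F \<mu> x v)" for x \<mu>
    using frechet_derivative_at[OF assms(1)] by simp
  moreover have "(\<lambda>x. E x \<mu>) differentiable (at x)" for x \<mu>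
    using assms(1) differentiable_def by blast
  ultimately show ?thesis
    using assms(2-4) by (auto simp: is_frame_def trivialization_def reality_condition_def matrix_inv_Inn
        matrix_inv_eqI(1)[OF orth])
qed

text \<open>With \<open>R y = matrix_inv (Q x) ** Q y - mat 1\<close> the equation becomes
  \<open>b y = matrix_inv (Q x) ** p y - R y ** b y\<close>, where only the inverse at the fixed
  point \<open>x\<close> occurs. As \<open>R\<close> vanishes at \<open>x\<close>, boundedness of
  \<open>b\<close> makes \<open>b\<close> continuous there, and continuity suffices for the product
  rule at a zero of the first factor.\<close>

lemma has_derivative_matrix_solve:
  fixes Q b p :: "'c::real_normed_vector \<Rightarrow> real ^ 'n ^ 'n"
  assumes Q: "(Q has_derivative Q') (at x)" and p: "(p has_derivative p') (at x)"
    and eq: "\<And>y. Q y ** b y = p y" and inv: "invertible (Q x)" and bounded: "bounded (range b)"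
  shows "(b has_derivative (\<lambda>h. matrix_inv (Q x) ** (p' h - Q' h ** b x))) (at x)"
proof -
  let ?I = "matrix_inv (Q x)"
  interpret M: bounded_bilinear "(**) :: real ^ 'n ^ 'n \<Rightarrow> real ^ 'n ^ 'n \<Rightarrow> real ^ 'n ^ 'n"
    by (rule bounded_bilinear_matrix_mult)
  define R where "R = (\<lambda>y. ?I ** Q y - mat 1)"
  have dR: "(R has_derivative (\<lambda>h. ?I ** Q' h)) (at x)"
    unfolding R_def
    using has_derivative_diff[OF bounded_linear.has_derivative[OF M.bounded_linear_right Q, of ?I]
        has_derivative_const[of "mat 1"]] by simp
  have dp: "((\<lambda>y. ?I ** p y) has_derivative (\<lambda>h. ?I ** p' h)) (at x)"
    by (rule bounded_linear.has_derivative[OF M.bounded_linear_right p])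
  have R0: "R x = 0" by (simp add: R_def matrix_inv_mult[OF inv])
  have b_eq: "b = (\<lambda>y. ?I ** p y - R y ** b y)"
    by (simp add: R_def matrix_distribs eq[symmetric])
  have "(R \<longlongrightarrow> 0) (at x)"
    using has_derivative_continuous[OF dR] R0 by (simp add: continuous_within)
  then have "Zfun R (at x)" by (simp add: tendsto_Zfun_iff)
  moreover obtain B where "\<And>y. norm (b y) \<le> B"
    using bounded unfolding bounded_iff by blast
  then have "Bfun b (at x)" by (intro BfunI[of _ B]) simp
  ultimately have "((\<lambda>y. R y ** b y) \<longlongrightarrow> 0) (at x)"
    using M.Zfun_prod_Bfun by (simp add: tendsto_Zfun_iff)
  moreover have "((\<lambda>y. ?I ** p y) \<longlongrightarrow> ?I ** p x) (at x)"
    using has_derivative_continuous[OF dp] by (simp add: continuous_within)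
  ultimately have "((\<lambda>y. ?I ** p y - R y ** b y) \<longlongrightarrow> ?I ** p x - 0) (at x)"
    by (intro tendsto_diff)
  moreover have "?I ** p x = b x"
    by (simp add: eq[symmetric] matrix_mul_assoc matrix_inv_mult[OF inv])
  ultimately have "isCont b x" by (simp add: isCont_def b_eq[symmetric])
  from has_derivative_diff[OF dp has_derivative_matrix_mult_zero[OF dR R0 this]]
  have "(b has_derivative (\<lambda>h. ?I ** p' h - ?I ** Q' h ** b x)) (at x)"
    by (simp add: b_eq[symmetric])
  then show ?thesis by (simp add: matrix_distribs)
qed

text \<open>The rows are unit vectors. The point is that the bound does not depend on the matrix,
  which supplies the boundedness asked for in \<open>has_derivative_matrix_solve\<close>.\<close>

lemma norm_orthogonal_le:
  fixes b :: "real ^ 'n ^ 'n"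
  assumes "b ** transpose b = mat 1"
  shows "norm b \<le> sqrt CARD('n)"
proof -
  have "norm (b $ i) = 1" for i
  proof -
    have "(b ** transpose b) $ i $ i = inner (b $ i) (b $ i)"
      by (simp add: matrix_matrix_mult_def transpose_def inner_vec_def)
    then show ?thesis by (simp add: assms mat_def norm_eq_sqrt_inner)
  qed
  then show ?thesis by (simp add: norm_vec_def L2_set_def)
qed

section \<open>The transformed orthogonal matrix\<close>

lemma map_Re_Im_simps [simp]:
  "map_matrix Re (cmat X) = X" "map_matrix Im (\<i> *c cmat X) = X"
  by (simp_all add: vec_eq_iff cscale_def)

locale dressing =
  fixes F :: "real ^ 'n \<Rightarrow> real ^ 'n ^ 'n"
    and E :: "real ^ 'n \<Rightarrow> complex \<Rightarrow> complex ^ ('n + 'n) ^ ('n + 'n)"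
    and s :: real and \<beta> :: "real ^ 'n ^ 'n"
  assumes solution: "is_solution F" and frame: "is_frame F E"
    and s_nonzero: "s \<noteq> 0" and \<beta>_orth: "orthogonal_matrix \<beta>"
begin

abbreviation \<eta> :: "real ^ 'n \<Rightarrow> complex ^ ('n + 'n) ^ ('n + 'n)"
  where "\<eta> x \<equiv> E x (- \<i> * complex_of_real s)"

definition e1 where "e1 x = map_matrix Re (blk11 (\<eta> x))"
definition e2 where "e2 x = map_matrix Im (blk12 (\<eta> x))"
definition e3 where "e3 x = map_matrix Im (blk21 (\<eta> x))"
definition e4 where "e4 x = map_matrix Re (blk22 (\<eta> x))"

definition num where "num x = \<beta> ** e1 x + e3 x"
definition den where "den x = e4 x - \<beta> ** e2 x"
definition b where "b x = matrix_inv (den x) ** num x"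

text \<open>The reality condition makes the diagonal blocks real and the off-diagonal blocks imaginary.\<close>

lemma \<eta>_eq: "\<eta> x = block (cmat (e1 x)) (\<i> *c cmat (e2 x)) (\<i> *c cmat (e3 x)) (cmat (e4 x))"
proof -
  have "map_matrix cnj (Inn ** \<eta> x ** Inn) = \<eta> x"
    using is_frameD(3)[OF frame, of x "- \<i> * of_real s"] is_frameD(2)[OF frame, of x "- \<i> * of_real s"]
    by simp
  then have "block (map_matrix cnj (blk11 (\<eta> x))) (map_matrix cnj (- blk12 (\<eta> x)))
      (map_matrix cnj (- blk21 (\<eta> x))) (map_matrix cnj (blk22 (\<eta> x))) =
    block (blk11 (\<eta> x)) (blk12 (\<eta> x)) (blk21 (\<eta> x)) (blk22 (\<eta> x))"
    by (metis block_exhaust Inn_conj_block block_simps(7))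
  then have "blk11 (\<eta> x) = cmat (e1 x)" "blk12 (\<eta> x) = \<i> *c cmat (e2 x)"
    "blk21 (\<eta> x) = \<i> *c cmat (e3 x)" "blk22 (\<eta> x) = cmat (e4 x)"
    unfolding block_eq_iff
    by (auto simp: vec_eq_iff e1_def e2_def e3_def e4_def cscale_def complex_eq_iff)
  then show ?thesis by (metis block_exhaust)
qed

lemma beta_den_eq: "beta_den s \<beta> E x = \<i> *c cmat (den x)"
  unfolding beta_den_def Let_def \<eta>_eq
  by (simp add: den_def cmat_simps cmat_mult matrix_distribs cscale_distribs)

lemma beta_num_eq: "beta_num s \<beta> E x = \<i> *c cmat (num x)"
  unfolding beta_num_def Let_def \<eta>_eq
  by (simp add: num_def cmat_simps cmat_mult matrix_distribs cscale_distribs)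

lemma \<eta>_orth:
  "e1 x ** transpose (e1 x) - e2 x ** transpose (e2 x) = mat 1"
  "e1 x ** transpose (e3 x) + e2 x ** transpose (e4 x) = 0"
  "e3 x ** transpose (e1 x) + e4 x ** transpose (e2 x) = 0"
  "e4 x ** transpose (e4 x) - e3 x ** transpose (e3 x) = mat 1"
proof -
  have "block (cmat (e1 x ** transpose (e1 x) - e2 x ** transpose (e2 x)))
      (\<i> *c cmat (e1 x ** transpose (e3 x) + e2 x ** transpose (e4 x)))
      (\<i> *c cmat (e3 x ** transpose (e1 x) + e4 x ** transpose (e2 x)))
      (cmat (e4 x ** transpose (e4 x) - e3 x ** transpose (e3 x))) = block (cmat (mat 1)) 0 0 (cmat (mat 1))"
    using is_frameD(4)[OF frame, of x "- \<i> * of_real s"]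
    unfolding \<eta>_eq
    by (simp add: block_simps block_mult matrix_distribs cmat_simps cmat_mult cscale_distribs)
  moreover have "\<i> *c cmat X = 0 \<longleftrightarrow> X = 0" for X :: "real ^ 'n ^ 'n"
    by (auto simp: vec_eq_iff cscale_def)
  ultimately show "e1 x ** transpose (e1 x) - e2 x ** transpose (e2 x) = mat 1"
    "e1 x ** transpose (e3 x) + e2 x ** transpose (e4 x) = 0"
    "e3 x ** transpose (e1 x) + e4 x ** transpose (e2 x) = 0"
    "e4 x ** transpose (e4 x) - e3 x ** transpose (e3 x) = mat 1"
    unfolding block_eq_iff cmat_eq_iff by auto
qed

lemma \<beta>_transpose: "\<beta> ** transpose \<beta> = mat 1"
  using \<beta>_orth by (simp add: orthogonal_matrix_def)

text \<open>Isotropy of the row block (i \<beta>, I): it is sent to (i \<open>num\<close>,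
  \<open>den\<close>) by the complex orthogonal matrix \<open>\<eta> x\<close>, so the products of
  the two blocks with their transposes cancel.\<close>

lemma num_den: "num x ** transpose (num x) = den x ** transpose (den x)"
proof -
  have 1: "e1 x ** transpose (e1 x) = mat 1 + e2 x ** transpose (e2 x)"
    and 2: "e1 x ** transpose (e3 x) = - (e2 x ** transpose (e4 x))"
    and 3: "e3 x ** transpose (e1 x) = - (e4 x ** transpose (e2 x))"
    and 4: "e4 x ** transpose (e4 x) = mat 1 + e3 x ** transpose (e3 x)"
    using \<eta>_orth[of x] by (simp_all add: algebra_simps eq_neg_iff_add_eq_0)
  have 5: "X ** e1 x ** transpose (e1 x) = X ** (mat 1 + e2 x ** transpose (e2 x))"
    "X ** e1 x ** transpose (e3 x) = X ** (- (e2 x ** transpose (e4 x)))" for X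
    by (simp_all add: matrix_mul_assoc[symmetric] 1 2)
  show ?thesis
    unfolding num_def den_def
    by (simp add: matrix_transpose_mul matrix_distribs 1 2 3 4 5 \<beta>_transpose)
qed

text \<open>A Bezout-type relation: it shows that a vector killed by both
  \<open>transpose (den x)\<close> and \<open>transpose (num x)\<close> is zero.\<close>

lemma den_transpose: "den x ** transpose (e4 x) - num x ** transpose (e3 x) = mat 1"
proof -
  have "den x ** transpose (e4 x) - num x ** transpose (e3 x) =
      (e4 x ** transpose (e4 x) - e3 x ** transpose (e3 x))
      - \<beta> ** (e1 x ** transpose (e3 x) + e2 x ** transpose (e4 x))"
    by (simp add: num_def den_def matrix_distribs)
  then show ?thesis by (simp add: \<eta>_orth)
qed

text \<open>If \<open>transpose (den x)\<close> kills a real vector, then by \<open>num_den\<close>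
  the image of that vector under \<open>transpose (num x)\<close> has norm zero, and
  \<open>den_transpose\<close> forces the vector to vanish. Reality enters through positivity of the
  inner product.\<close>

lemma invertible_den: "invertible (den x)"
proof -
  have "v = 0" if v: "transpose (den x) *v v = 0" for v
  proof -
    have "inner (transpose (num x) *v v) (transpose (num x) *v v) =
        inner v ((num x ** transpose (num x)) *v v)"
      by (simp add: dot_lmul_matrix matrix_vector_mul_assoc[symmetric])
    also have "\<dots> = inner v (den x *v (transpose (den x) *v v))"
      by (simp only: num_den matrix_vector_mul_assoc)
    finally have "transpose (num x) *v v = 0"
      unfolding v by (simp del: transpose_matrix_vector)
    moreover have "v = transpose (den x ** transpose (e4 x) - num x ** transpose (e3 x)) *v v"
      by (simp add: den_transpose)
    then have "v = e4 x *v (transpose (den x) *v v) - e3 x *v (transpose (num x) *v v)"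
      by (simp only: transpose_simps matrix_transpose_mul transpose_transpose
          matrix_vector_mult_diff_rdistrib matrix_vector_mul_assoc)
    ultimately show "v = 0" using v by simp
  qed
  then have "\<exists>B. B ** transpose (den x) = mat 1"
    by (simp add: matrix_left_invertible_ker)
  then have "invertible (transpose (den x))"
    by (simp add: invertible_left_inverse)
  then show ?thesis using transpose_invertible by fastforce
qed

lemma den_b: "den x ** b x = num x"
  by (simp add: b_def matrix_mul_assoc matrix_inv_mult[OF invertible_den])

lemma b_orth: "b x ** transpose (b x) = mat 1" "transpose (b x) ** b x = mat 1"
proof -
  have "den x ** (b x ** transpose (b x)) ** transpose (den x) = den x ** transpose (den x)"
    using num_den[of x] by (simp add: den_b[symmetric] matrix_transpose_mul matrix_mul_assoc)
  then have "matrix_inv (den x) ** (den x ** (b x ** transpose (b x)) ** transpose (den x))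
      ** matrix_inv (transpose (den x)) =
    matrix_inv (den x) ** (den x ** transpose (den x)) ** matrix_inv (transpose (den x))" by simp
  then show *: "b x ** transpose (b x) = mat 1"
    using matrix_inv_mult[OF invertible_den, of x]
      matrix_inv_mult[OF transpose_invertible[OF invertible_den], of x]
    by (metis matrix_mul_assoc matrix_mul_lid matrix_mul_rid)
  then show "transpose (b x) ** b x = mat 1"
    using matrix_left_right_inverse by blast
qed

lemma beta_den_b:
  "invertible (beta_den s \<beta> E x)"
  "cmat (b x) = matrix_inv (beta_den s \<beta> E x) ** beta_num s \<beta> E x"
proof -
  have "cmat (den x) ** cmat (matrix_inv (den x)) = mat 1"
    by (simp add: cmat_mult[symmetric] matrix_inv_mult[OF invertible_den] cmat_simps)
  then have *: "beta_den s \<beta> E x ** ((- \<i>) *c cmat (matrix_inv (den x))) = mat 1"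
    by (simp add: beta_den_eq matrix_distribs)
  show "invertible (beta_den s \<beta> E x)"
    by (rule matrix_inv_eqI(1)[OF *])
  show "cmat (b x) = matrix_inv (beta_den s \<beta> E x) ** beta_num s \<beta> E x"
    by (simp add: matrix_inv_eqI(2)[OF *] beta_num_eq matrix_distribs b_def cmat_mult)
qed

text \<open>At the parameter -is the factors of i combine so that the frame equation becomes a real
  linear system for the four blocks.\<close>

lemma has_derivative_\<eta>_blocks:
  "(e1 has_derivative (\<lambda>v. e1 x ** conn (F x) v + s *\<^sub>R (e2 x ** dmat v))) (at x)"
  "(e2 has_derivative (\<lambda>v. s *\<^sub>R (e1 x ** dmat v) + e2 x ** conn (transpose (F x)) v)) (at x)"
  "(e3 has_derivative (\<lambda>v. e3 x ** conn (F x) v - s *\<^sub>R (e4 x ** dmat v))) (at x)"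
  "(e4 has_derivative (\<lambda>v. - (s *\<^sub>R (e3 x ** dmat v)) + e4 x ** conn (transpose (F x)) v)) (at x)"
proof -
  let ?A = "\<lambda>v. conn (F x) v" and ?B = "\<lambda>v. conn (transpose (F x)) v"
  have ii: "\<i> * c * \<i> = - c" for c
    by (simp add: complex_eq_iff)
  note d = is_frameD(1)[OF frame, where \<mu> = "- \<i> * of_real s" and x = x]
  have eq: "\<eta> x ** theta F (- \<i> * of_real s) x v =
    block (cmat (e1 x ** ?A v + s *\<^sub>R (e2 x ** dmat v)))
      (\<i> *c cmat (s *\<^sub>R (e1 x ** dmat v) + e2 x ** ?B v))
      (\<i> *c cmat (e3 x ** ?A v - s *\<^sub>R (e4 x ** dmat v)))
      (cmat (- (s *\<^sub>R (e3 x ** dmat v)) + e4 x ** ?B v))" for v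
    unfolding \<eta>_eq theta_eq
    by (simp add: block_mult block_eq_iff matrix_distribs cmat_simps cmat_mult cscale_distribs ii)
  note d = d[unfolded eq]
  show "(e1 has_derivative (\<lambda>v. e1 x ** ?A v + s *\<^sub>R (e2 x ** dmat v))) (at x)"
    using bounded_linear.has_derivative[OF bounded_linear_map_Re
        bounded_linear.has_derivative[OF bounded_linear_blk(1) d]]
    by (simp add: e1_def[abs_def])
  show "(e2 has_derivative (\<lambda>v. s *\<^sub>R (e1 x ** dmat v) + e2 x ** ?B v)) (at x)"
    using bounded_linear.has_derivative[OF bounded_linear_map_Im
        bounded_linear.has_derivative[OF bounded_linear_blk(2) d]]
    by (simp add: e2_def[abs_def])
  show "(e3 has_derivative (\<lambda>v. e3 x ** ?A v - s *\<^sub>R (e4 x ** dmat v))) (at x)"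
    using bounded_linear.has_derivative[OF bounded_linear_map_Im
        bounded_linear.has_derivative[OF bounded_linear_blk(3) d]]
    by (simp add: e3_def[abs_def])
  show "(e4 has_derivative (\<lambda>v. - (s *\<^sub>R (e3 x ** dmat v)) + e4 x ** ?B v)) (at x)"
    using bounded_linear.has_derivative[OF bounded_linear_map_Re
        bounded_linear.has_derivative[OF bounded_linear_blk(4) d]]
    by (simp add: e4_def[abs_def])
qed

text \<open>The pair \<open>num\<close>, \<open>den\<close> obeys a linear system, coupled through
  \<open>s\<close> and \<open>dmat v\<close>. The quotient of the two components of such a system
  satisfies a Riccati equation.\<close>

lemma has_derivative_b: "(b has_derivative dressing_deriv s (F x) (b x)) (at x)"
proof -
  interpret M: bounded_bilinear "(**) :: real ^ 'n ^ 'n \<Rightarrow> real ^ 'n ^ 'n \<Rightarrow> real ^ 'n ^ 'n"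
    by (rule bounded_bilinear_matrix_mult)
  note E = has_derivative_\<eta>_blocks
  have num: "(num has_derivative (\<lambda>v. num x ** conn (F x) v - s *\<^sub>R (den x ** dmat v))) (at x)"
    unfolding num_def[abs_def] den_def
    by (rule has_derivative_eq_rhs[OF has_derivative_add[OF
          bounded_linear.has_derivative[OF M.bounded_linear_right E(1)] E(3)]])
       (simp add: fun_eq_iff matrix_distribs scaleR_right_diff_distrib)
  have den: "(den has_derivative (\<lambda>v. den x ** conn (transpose (F x)) v - s *\<^sub>R (num x ** dmat v))) (at x)"
    unfolding num_def den_def[abs_def]
    by (rule has_derivative_eq_rhs[OF has_derivative_diff[OF E(4)
          bounded_linear.has_derivative[OF M.bounded_linear_right E(2)]]])
       (simp add: fun_eq_iff matrix_distribs scaleR_right_distrib)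
  have bdd: "bounded (range b)"
    unfolding bounded_iff using norm_orthogonal_le[OF b_orth(1)] by blast
  have "matrix_inv (den x) ** (num x ** conn (F x) v - s *\<^sub>R (den x ** dmat v)
      - (den x ** conn (transpose (F x)) v - s *\<^sub>R (num x ** dmat v)) ** b x) =
    dressing_deriv s (F x) (b x) v" for v
    by (simp add: matrix_distribs dressing_deriv_def matrix_inv_mult[OF invertible_den] b_def[symmetric])
  then show ?thesis
    using has_derivative_matrix_solve[OF den num den_b invertible_den bdd] by simp
qed

text \<open>Bootstrapping: the derivative is a polynomial in \<open>b\<close> and \<open>F\<close>,
  so each order of differentiability of \<open>b\<close> gives the next one.\<close>

lemma smooth_b: "smooth b"
proof -
  have mult: "C_k k (\<lambda>x. f x ** g x)" if "C_k k f" "C_k k g"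
    for k and f g :: "real ^ 'n \<Rightarrow> real ^ 'n ^ 'n"
    by (rule C_k_bilinear[OF bounded_bilinear_matrix_mult that])
  have "C_k k b" for k
  proof (induction k)
    case 0
    show ?case
      using has_derivative_continuous[OF has_derivative_b]
      by (simp add: continuous_at_imp_continuous_on)
  next
    case (Suc k)
    have F: "C_k k F" using solution by (simp add: is_solution_def smooth_def)
    have conn: "C_k k (\<lambda>x. conn (F x) v)" "C_k k (\<lambda>x. conn (transpose (F x)) v)" for v
      by (intro C_k_linear[OF bounded_linear_conn] C_k_linear[OF bounded_linear_transpose] F)+
    show ?case
      by (rule C_k_SucI[OF has_derivative_b], unfold dressing_deriv_def)
         (intro C_k_add C_k_diff mult C_k_const C_k_linear[OF bounded_linear_scaleR_right] conn Suc)
  qed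
  then show ?thesis by (simp add: smooth_def)
qed

definition F' where "F' x = transpose (F x) + s *\<^sub>R off_diag (b x)"

lemma solution_F': "is_solution F'"
proof -
  have smooth_F: "\<And>k. C_k k F" and gl: "\<And>x. F x \<in> gl_star" and flat: "flat (theta F 0)"
    using solution by (auto simp: is_solution_def smooth_def)
  have dF: "(F has_derivative frechet_derivative F (at x)) (at x)" for x
    by (rule C_k_differentiable[OF smooth_F])
  let ?dF = "\<lambda>x. frechet_derivative F (at x)"
  let ?dF' = "\<lambda>x v. transpose (?dF x v) + s *\<^sub>R off_diag (dressing_deriv s (F x) (b x) v)"
  have dF': "(F' has_derivative ?dF' x) (at x)" for x
    unfolding F'_def[abs_def]
    by (intro has_derivative_add bounded_linear.has_derivative[OF bounded_linear_transpose] dF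
        has_derivative_scaleR_right bounded_linear.has_derivative[OF bounded_linear_off_diag] has_derivative_b)
  have curv: "curv (F x) (?dF x) u v = 0" "curv (transpose (F x)) (\<lambda>v. transpose (?dF x v)) u v = 0" for x u v
    using flat_theta_iff[of F ?dF 0, OF dF] flat by auto
  have "curv (F' x) (?dF' x) u v = 0" for x u v
    unfolding F'_def by (rule curv_dressed[OF b_orth curv(2)])
  \<comment> \<open>The same identity applied to \<open>transpose (F x)\<close> and
    \<open>transpose (b x)\<close>; the Riccati derivative transposes accordingly.\<close>
  moreover have "curv (transpose (F' x)) (\<lambda>v. transpose (?dF' x v)) u v = 0" for x u v
    using curv_dressed[of "transpose (b x)" "transpose (F x)" "\<lambda>v. transpose (?dF x v)" u v s]
      b_orth[of x] curv(1)[of x u v]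
    by (simp add: F'_def transpose_scalar transpose_off_diag transpose_dressing_deriv)
  ultimately have "flat (theta F' \<mu>)" for \<mu>
    using flat_theta_iff[of F' ?dF' \<mu>, OF dF'] by blast
  moreover have "smooth F'"
    unfolding smooth_def F'_def[abs_def]
    using smooth_b[unfolded smooth_def]
    by (auto intro!: C_k_add C_k_linear[OF bounded_linear_scaleR_right] C_k_linear[OF bounded_linear_off_diag]
        C_k_linear[OF bounded_linear_transpose] smooth_F)
  moreover have "F' x \<in> gl_star" for x
    using gl[of x] by (simp add: gl_star_def F'_def off_diag_def transpose_def)
  ultimately show ?thesis by (simp add: is_solution_def)
qed

end

section \<open>The transformed frame\<close>

text \<open>The numerator of \<open>kmat\<close>. It is polynomial in the parameter and, for
  orthogonal \<open>\<beta>\<close>, inverted up to a scalar by its own transpose, so inverses can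
  be replaced by transposes throughout.\<close>

definition Kmat :: "real \<Rightarrow> real ^ 'n ^ 'n \<Rightarrow> complex \<Rightarrow> complex ^ ('n + 'n) ^ ('n + 'n)"
  where "Kmat s \<beta> \<mu> = block (complex_of_real s *c cmat \<beta>) (\<mu> *c mat 1) (- (\<mu> *c mat 1))
    (complex_of_real s *c cmat (transpose \<beta>))"

lemma kmat_eq: "kmat s \<beta> \<mu> = (1 / (\<mu> - \<i> * of_real s)) *c Kmat s \<beta> \<mu>"
  by (simp add: kmat_def Kmat_def cmat_simps)

lemma transpose_Kmat: "transpose (Kmat s \<beta> \<mu>) = Kmat s (transpose \<beta>) (- \<mu>)"
  by (simp add: Kmat_def block_simps cmat_simps)

lemma cscale_mat_block:
  "c *c (mat 1 :: complex ^ ('n + 'n) ^ ('n + 'n)) = block (c *c mat 1) 0 0 (c *c (mat 1 :: complex ^ 'n ^ 'n))"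
  by (simp add: block_simps(6)[symmetric] block_simps(8))

lemma Kmat_orth:
  assumes "\<beta> ** transpose \<beta> = mat 1"
  shows "Kmat s \<beta> \<mu> ** transpose (Kmat s \<beta> \<mu>) = (\<mu>\<^sup>2 + (of_real s)\<^sup>2) *c mat 1"
    "transpose (Kmat s \<beta> \<mu>) ** Kmat s \<beta> \<mu> = (\<mu>\<^sup>2 + (of_real s)\<^sup>2) *c mat 1"
proof -
  have "transpose \<beta> ** \<beta> = mat 1"
    using assms matrix_left_right_inverse by blast
  then have "cmat \<beta> ** cmat (transpose \<beta>) = mat 1" "cmat (transpose \<beta>) ** cmat \<beta> = mat 1"
    using assms by (simp_all add: cmat_mult[symmetric] cmat_simps(5))
  then show "Kmat s \<beta> \<mu> ** transpose (Kmat s \<beta> \<mu>) = (\<mu>\<^sup>2 + (of_real s)\<^sup>2) *c mat 1"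
    "transpose (Kmat s \<beta> \<mu>) ** Kmat s \<beta> \<mu> = (\<mu>\<^sup>2 + (of_real s)\<^sup>2) *c mat 1"
    by (simp_all add: transpose_Kmat cscale_mat_block)
       (simp_all add: Kmat_def block_mult block_eq_iff matrix_distribs cscale_distribs power2_eq_square mult.commute)
qed

lemma Kmat_cnj: "map_matrix cnj (Kmat s \<beta> (cnj \<mu>)) = Kmat s \<beta> \<mu>"
  by (simp add: Kmat_def block_simps map_cnj_simps)

lemma Kmat_Inn: "Inn ** Kmat s \<beta> \<mu> ** Inn = Kmat s \<beta> (- \<mu>)"
  by (simp add: Kmat_def Inn_conj_block)

section \<open>Entire matrix functions and removal of two simple poles\<close>

definition entrywise_holomorphic :: "(complex \<Rightarrow> complex ^ 'n ^ 'm) \<Rightarrow> bool"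
  where "entrywise_holomorphic A \<longleftrightarrow> (\<forall>i j. (\<lambda>\<mu>. A \<mu> $ i $ j) holomorphic_on UNIV)"

lemma entrywise_holomorphic_mult:
  assumes "entrywise_holomorphic A" "entrywise_holomorphic B"
  shows "entrywise_holomorphic (\<lambda>\<mu>. A \<mu> ** B \<mu>)"
  using assms by (auto simp: entrywise_holomorphic_def matrix_matrix_mult_def intro!: holomorphic_intros)

lemma entrywise_holomorphic_Kmat: "entrywise_holomorphic (Kmat s \<beta>)"
  by (auto simp: entrywise_holomorphic_def Kmat_def forall_sum cscale_def mat_def intro!: holomorphic_intros)

lemma entrywise_holomorphic_transpose:
  "entrywise_holomorphic A \<Longrightarrow> entrywise_holomorphic (\<lambda>\<mu>. transpose (A \<mu>))"
  by (auto simp: entrywise_holomorphic_def transpose_def)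

text \<open>The linear factors are divided out one at a time. Since \<open>a\<close> is nonzero,
  \<open>- a\<close> differs from \<open>a\<close> and is still a zero after the first
  division.\<close>

lemma holomorphic_quotient_two_zeros:
  assumes "f holomorphic_on UNIV" "f a = 0" "f (- a) = 0" "a \<noteq> (0 :: complex)"
  obtains h where "h holomorphic_on UNIV" "\<And>z. z \<noteq> a \<Longrightarrow> z \<noteq> - a \<Longrightarrow> h z = f z / (z\<^sup>2 - a\<^sup>2)"
proof -
  define g where "g = (\<lambda>z. if z = a then deriv f a else (f z - f a) / (z - a))"
  define h where "h = (\<lambda>z. if z = - a then deriv g (- a) else (g z - g (- a)) / (z - (- a)))"
  have "g holomorphic_on UNIV"
    unfolding g_def by (rule pole_lemma_open[OF assms(1) open_UNIV])
  then have "h holomorphic_on UNIV"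
    unfolding h_def by (rule pole_lemma_open[OF _ open_UNIV])
  moreover have "g (- a) = 0" using assms by (simp add: g_def)
  then have "h z = f z / (z\<^sup>2 - a\<^sup>2)" if "z \<noteq> a" "z \<noteq> - a" for z
    using that assms(2) by (simp add: h_def g_def power2_eq_square algebra_simps)
  ultimately show ?thesis using that by blast
qed

text \<open>The form is bilinear in the value of \<open>F\<close> and the tangent vector, plus a
  part linear in the vector and constant in \<open>x\<close>; on a compact ball the continuous
  \<open>F\<close> is bounded.\<close>

lemma theta_locally_bounded:
  assumes "continuous_on UNIV F"
  shows "\<exists>r>0. \<exists>C. \<forall>x\<in>cball x0 r. \<forall>v. norm (theta F \<mu> x v) \<le> C * norm v"
proof -
  have "bounded_bilinear (\<lambda>G v. block (cmat (conn G v)) 0 0 (cmat (conn (transpose G) v)))"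
    unfolding bilinear_conv_bounded_bilinear[symmetric] bilinear_def
    by (auto intro!: linearI simp: vec_eq_iff forall_sum conn_def dmat_mult_nth transpose_def
        complex_eq_iff algebra_simps)
  then obtain K where "K > 0" and K: "\<And>(G :: real ^ 'a ^ 'a) v.
      norm (block (cmat (conn G v)) 0 0 (cmat (conn (transpose G) v))) \<le> norm G * norm v * K"
    using bounded_bilinear.pos_bounded by blast
  have "bounded_linear (\<lambda>v :: real ^ 'a. block 0 (- (\<mu> *c cmat (dmat v))) (\<mu> *c cmat (dmat v)) 0)"
    by (rule bounded_linear_matrix)
       (auto simp: vec_eq_iff forall_sum cscale_def dmat_def complex_eq_iff algebra_simps)
  then obtain L where L: "\<And>v :: real ^ 'a.
      norm (block 0 (- (\<mu> *c cmat (dmat v))) (\<mu> *c cmat (dmat v)) 0) \<le> norm v * L"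
    using bounded_linear.bounded by blast
  have "compact (F ` cball x0 1)"
    using assms by (intro compact_continuous_image compact_cball) (rule continuous_on_subset, auto)
  then obtain B where B: "\<And>x. x \<in> cball x0 1 \<Longrightarrow> norm (F x) \<le> B"
    using compact_imp_bounded bounded_iff by (metis imageI)
  have "norm (theta F \<mu> x v) \<le> (B * K + L) * norm v" if "x \<in> cball x0 1" for x v
  proof -
    have "theta F \<mu> x v = block (cmat (conn (F x) v)) 0 0 (cmat (conn (transpose (F x)) v))
        + block 0 (- (\<mu> *c cmat (dmat v))) (\<mu> *c cmat (dmat v)) 0"
      by (simp add: theta_eq block_simps)
    also have "norm \<dots> \<le> norm (F x) * norm v * K + norm v * L"
      by (intro norm_triangle_mono K L)
    also have "\<dots> \<le> B * norm v * K + norm v * L"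
      using B[OF that] \<open>K > 0\<close> by (intro add_right_mono mult_right_mono) auto
    finally show ?thesis by (simp add: algebra_simps)
  qed
  then show ?thesis by (intro exI[of _ 1] conjI exI[of _ "B * K + L"]) auto
qed

text \<open>\<open>F\<close> occurs only in the part free of the parameter and drops out of the
  difference. The constant is therefore uniform in \<open>F\<close> and in the point, as the global
  error bound in \<open>limit_of_parallel\<close> demands.\<close>

lemma theta_Lipschitz_parameter:
  "\<exists>C. \<forall>(F :: real ^ 'n \<Rightarrow> real ^ 'n ^ 'n) \<mu> \<nu> x v.
    norm (theta F \<mu> x v - theta F \<nu> x v) \<le> norm (\<mu> - \<nu>) * C * norm v"
proof -
  have "bounded_bilinear (\<lambda>\<mu> v :: real ^ 'n. block 0 (- (\<mu> *c cmat (dmat v))) (\<mu> *c cmat (dmat v)) 0)"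
    unfolding bilinear_conv_bounded_bilinear[symmetric] bilinear_def
    by (auto intro!: linearI simp: vec_eq_iff forall_sum cscale_def dmat_def complex_eq_iff algebra_simps)
  then obtain C where C: "\<And>\<mu> v :: real ^ 'n.
      norm (block 0 (- (\<mu> *c cmat (dmat v))) (\<mu> *c cmat (dmat v)) 0) \<le> norm \<mu> * norm v * C"
    using bounded_bilinear.bounded by blast
  have "norm (theta F \<mu> x v - theta F \<nu> x v) \<le> norm (\<mu> - \<nu>) * C * norm v"
    for F :: "real ^ 'n \<Rightarrow> real ^ 'n ^ 'n" and \<mu> \<nu> x v
  proof -
    have "theta F \<mu> x v - theta F \<nu> x v =
        block 0 (- ((\<mu> - \<nu>) *c cmat (dmat v))) ((\<mu> - \<nu>) *c cmat (dmat v)) 0"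
      by (simp add: theta_eq block_simps cscale_distribs)
    then show ?thesis using C[of "\<mu> - \<nu>" v] by (simp add: algebra_simps)
  qed
  then show ?thesis by blast
qed

section \<open>The dressed frame away from the poles, and its numerator at the poles\<close>

context dressing
begin

definition pole :: "complex \<Rightarrow> bool"
  where "pole \<mu> \<longleftrightarrow> \<mu> = \<i> * of_real s \<or> \<mu> = - \<i> * of_real s"

lemma denominator_eq: "\<mu>\<^sup>2 + (of_real s)\<^sup>2 = (\<mu> - \<i> * of_real s) * (\<mu> + \<i> * of_real s)"
  by (simp add: algebra_simps power2_eq_square)

lemma denominator_nonzero: "\<not> pole \<mu> \<Longrightarrow> \<mu>\<^sup>2 + (of_real s)\<^sup>2 \<noteq> 0"
  unfolding denominator_eq by (auto simp: pole_def add_eq_0_iff2)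

lemma pole_cnj: "pole (cnj \<mu>) \<longleftrightarrow> pole \<mu>"
  by (auto simp: pole_def complex_eq_iff)

lemma pole_uminus: "pole (- \<mu>) \<longleftrightarrow> pole \<mu>"
  by (auto simp: pole_def complex_eq_iff)

text \<open>The inverse of \<open>kmat\<close> is a scalar multiple of the transpose of
  \<open>Kmat\<close>, and the factors \<open>\<mu> - \<i> * of_real s\<close> of the two dressing
  matrices cancel. Up to one scalar denominator the dressed frame is thus this polynomial expression
  in the dressing data and \<open>E\<close>.\<close>

definition N where "N x \<mu> = Kmat s \<beta> \<mu> ** E x \<mu> ** transpose (Kmat s (b x) \<mu>)"

text \<open>Division by zero yields zero, so at the poles this is the zero matrix. Hence the
  derivative and symmetry statements below hold for every \<open>\<mu>\<close>, and only
  orthogonality and the comparison with \<open>kmat\<close> exclude the poles.\<close>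

definition D where "D x \<mu> = (1 / (\<mu>\<^sup>2 + (of_real s)\<^sup>2)) *c N x \<mu>"

lemma N_cnj: "map_matrix cnj (N x (cnj \<mu>)) = N x \<mu>"
  by (simp add: N_def map_cnj_mult map_cnj_simps(3) Kmat_cnj is_frameD(2)[OF frame])

lemma N_Inn: "Inn ** N x \<mu> ** Inn = N x (- \<mu>)"
  by (simp add: N_def Inn_conj_mult transpose_Kmat Kmat_Inn is_frameD(3)[OF frame])

lemma D_cnj: "map_matrix cnj (D x (cnj \<mu>)) = D x \<mu>"
  by (simp add: D_def map_cnj_simps N_cnj)

lemma D_Inn: "Inn ** D x \<mu> ** Inn = D x (- \<mu>)"
  by (simp add: D_def matrix_distribs N_Inn)

lemma D_orth:
  assumes "\<not> pole \<mu>"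
  shows "D x \<mu> ** transpose (D x \<mu>) = mat 1"
proof -
  let ?c = "\<mu>\<^sup>2 + (of_real s)\<^sup>2"
  have "N x \<mu> ** transpose (N x \<mu>) =
    Kmat s \<beta> \<mu> ** E x \<mu> ** (transpose (Kmat s (b x) \<mu>) ** Kmat s (b x) \<mu>) **
      transpose (E x \<mu>) ** transpose (Kmat s \<beta> \<mu>)"
    by (simp add: N_def matrix_transpose_mul matrix_mul_assoc)
  also have "\<dots> = ?c *c (Kmat s \<beta> \<mu> ** (E x \<mu> ** transpose (E x \<mu>)) ** transpose (Kmat s \<beta> \<mu>))"
    by (simp add: Kmat_orth(2)[OF b_orth(1)] matrix_cscale_left matrix_cscale_right matrix_mul_assoc)
  also have "\<dots> = (?c * ?c) *c mat 1"
    by (simp add: is_frameD(4)[OF frame] Kmat_orth(1)[OF \<beta>_transpose])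
  finally show ?thesis
    using denominator_nonzero[OF assms] by (simp add: D_def matrix_distribs)
qed

lemma D_eq_dressed:
  assumes "\<not> pole \<mu>"
  shows "invertible (kmat s (b x) \<mu>)"
    "D x \<mu> = kmat s \<beta> \<mu> ** E x \<mu> ** matrix_inv (kmat s (b x) \<mu>)"
proof -
  have nz: "\<mu> - \<i> * of_real s \<noteq> 0" "\<mu> + \<i> * of_real s \<noteq> 0"
    using assms by (auto simp: pole_def add_eq_0_iff2)
  have *: "kmat s (b x) \<mu> ** ((1 / (\<mu> + \<i> * of_real s)) *c transpose (Kmat s (b x) \<mu>)) = mat 1"
    using nz by (simp add: kmat_eq matrix_distribs Kmat_orth(1)[OF b_orth(1)] denominator_eq)
  show "invertible (kmat s (b x) \<mu>)" by (rule matrix_inv_eqI(1)[OF *])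
  show "D x \<mu> = kmat s \<beta> \<mu> ** E x \<mu> ** matrix_inv (kmat s (b x) \<mu>)"
    unfolding matrix_inv_eqI(2)[OF *]
    by (simp add: D_def N_def kmat_eq matrix_distribs denominator_eq mult.commute)
qed

text \<open>Compared block by block: the off-diagonal blocks, linear in \<open>\<mu>\<close>,
  dictate the passage from \<open>transpose (F x)\<close> to \<open>F' x\<close>; the diagonal
  blocks are the Riccati system for \<open>b x\<close> and its transpose, since their terms in the
  square of \<open>\<mu>\<close> agree on both sides.\<close>

lemma gauge_identity:
  "theta F \<mu> x v ** transpose (Kmat s (b x) \<mu>)
     + block (of_real s *c cmat (transpose (dressing_deriv s (F x) (b x) v))) 0 0
         (of_real s *c cmat (dressing_deriv s (F x) (b x) v)) =
   transpose (Kmat s (b x) \<mu>) ** theta F' \<mu> x v"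
proof -
  let ?b = "cmat (b x)" and ?t = "cmat (transpose (b x))"
  have tb: "?t ** ?b = mat 1" "?b ** ?t = mat 1"
    "X ** ?t ** ?b = X" "X ** ?b ** ?t = X" for X
    using b_orth[of x] by (simp_all add: matrix_mul_assoc[symmetric] cmat_mult[symmetric] cmat_simps(5))
  have F': "conn (F' x) v = conn (transpose (F x)) v + s *\<^sub>R (dmat v ** transpose (b x) - b x ** dmat v)"
    "conn (transpose (F' x)) v = conn (F x) v + s *\<^sub>R (dmat v ** b x - transpose (b x) ** dmat v)"
    unfolding F'_def by (simp_all add: conn_add conn_scaleR conn_off_diag transpose_scalar transpose_off_diag)
      (simp_all add: conn_def)
  show ?thesis
    unfolding theta_eq transpose_Kmat F' transpose_dressing_deriv
    by (simp add: Kmat_def dressing_deriv_def block_mult block_simps block_eq_iff cmat_simps(1,2,3,6)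
        cmat_mult matrix_distribs cscale_distribs tb)
       (simp add: algebra_simps)
qed

lemma has_derivative_D:
  "((\<lambda>x. D x \<mu>) has_derivative (\<lambda>v. D x \<mu> ** theta F' \<mu> x v)) (at x)"
proof -
  interpret M: bounded_bilinear
    "(**) :: complex ^ ('n + 'n) ^ ('n + 'n) \<Rightarrow> complex ^ ('n + 'n) ^ ('n + 'n) \<Rightarrow> complex ^ ('n + 'n) ^ ('n + 'n)"
    by (rule bounded_bilinear_matrix_mult)
  have lin: "bounded_linear (\<lambda>B. block (of_real s *c cmat (transpose B)) 0 0 (of_real s *c cmat B))"
    by (rule bounded_linear_matrix)
       (auto simp: vec_eq_iff forall_sum cscale_def transpose_def complex_eq_iff algebra_simps)
  have K: "transpose (Kmat s (b x) \<mu>) = block (of_real s *c cmat (transpose (b x))) 0 0 (of_real s *c cmat (b x))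
      + block 0 (- (\<mu> *c mat 1)) (\<mu> *c mat 1) 0" for x
    by (simp add: transpose_Kmat Kmat_def block_simps cmat_simps(7))
  have "((\<lambda>x. transpose (Kmat s (b x) \<mu>)) has_derivative
      (\<lambda>v. block (of_real s *c cmat (transpose (dressing_deriv s (F x) (b x) v))) 0 0
         (of_real s *c cmat (dressing_deriv s (F x) (b x) v)))) (at x)"
    unfolding K
    using has_derivative_add[OF bounded_linear.has_derivative[OF lin has_derivative_b] has_derivative_const] by simp
  from M.FDERIV[OF bounded_linear.has_derivative[OF M.bounded_linear_right is_frameD(1)[OF frame]] this]
  have "((\<lambda>x. N x \<mu>) has_derivative (\<lambda>v. N x \<mu> ** theta F' \<mu> x v)) (at x)"
    unfolding N_def
    by (rule has_derivative_eq_rhs)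
       (simp add: fun_eq_iff matrix_mul_assoc[symmetric] gauge_identity[symmetric] matrix_add_ldistrib add.commute)
  from bounded_linear.has_derivative[OF bounded_linear_cscale this]
  show ?thesis by (simp add: D_def matrix_cscale_left)
qed

text \<open>At -is the rows of \<open>Kmat s \<beta>\<close> times \<open>\<eta> x\<close> are
  multiples of those of (\<open>b x\<close>, -i I). This block is isotropic because
  \<open>b x\<close> is orthogonal, and the transpose of \<open>Kmat s (b x)\<close> annihilates
  it.\<close>

lemma N_pole:
  assumes "pole \<mu>"
  shows "N x \<mu> = 0"
proof -
  have \<beta>\<beta>: "X ** cmat (transpose \<beta>) ** cmat \<beta> = X" "cmat (transpose \<beta>) ** cmat \<beta> = mat 1" for X
    using \<beta>_orth by (simp_all add: matrix_mul_assoc[symmetric] cmat_mult[symmetric] cmat_simps(5) orthogonal_matrix_def)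
  have bb: "X ** cmat (b x) ** cmat (transpose (b x)) = X" for X
    using b_orth[of x] by (simp add: matrix_mul_assoc[symmetric] cmat_mult[symmetric] cmat_simps(5))
  let ?d = "cmat (den x)"
  have n: "cmat \<beta> ** cmat (e1 x) + cmat (e3 x) = ?d ** cmat (b x)"
    "cmat (e4 x) - cmat \<beta> ** cmat (e2 x) = ?d"
    by (simp_all add: cmat_mult[symmetric] cmat_simps(1,2)[symmetric] den_b) (simp_all add: num_def den_def)
  have t: "cmat (e1 x) + cmat (transpose \<beta>) ** cmat (e3 x) = cmat (transpose \<beta>) ** ?d ** cmat (b x)"
    "cmat (transpose \<beta>) ** cmat (e4 x) - cmat (e2 x) = cmat (transpose \<beta>) ** ?d"
    unfolding matrix_mul_assoc[symmetric] n(1)[symmetric] by (simp add: matrix_distribs \<beta>\<beta>)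
      (unfold n(2)[symmetric], simp add: matrix_distribs \<beta>\<beta>)
  have K: "Kmat s \<beta> (- \<i> * of_real s) ** \<eta> x = of_real s *c
      block (?d ** cmat (b x)) (- (\<i> *c ?d)) (\<i> *c (cmat (transpose \<beta>) ** ?d ** cmat (b x)))
        (cmat (transpose \<beta>) ** ?d)"
  proof -
    have "Kmat s \<beta> (- \<i> * of_real s) ** \<eta> x = of_real s *c
      block (cmat \<beta> ** cmat (e1 x) + cmat (e3 x)) (- (\<i> *c (cmat (e4 x) - cmat \<beta> ** cmat (e2 x))))
        (\<i> *c (cmat (e1 x) + cmat (transpose \<beta>) ** cmat (e3 x)))
        (cmat (transpose \<beta>) ** cmat (e4 x) - cmat (e2 x))"
      unfolding \<eta>_eq Kmat_def
      by (simp add: block_mult block_simps block_eq_iff matrix_distribs cscale_distribs)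
         (simp add: algebra_simps)
    then show ?thesis by (simp only: n t)
  qed
  have sc: "complex_of_real s * (of_real s * \<i>) = \<i> * of_real s * of_real s"
    "\<i> * complex_of_real s * (of_real s * \<i>) = - (of_real s * of_real s)"
    by (simp_all add: complex_eq_iff)
  have "N x (- \<i> * of_real s) = 0"
    unfolding N_def K transpose_Kmat
    by (simp add: Kmat_def block_mult block_simps block_eq_0_iff matrix_distribs cscale_distribs bb sc)
  \<comment> \<open>Conjugation exchanges the two poles and, by \<open>N_cnj\<close>, preserves the
    vanishing of the numerator.\<close>
  moreover from this have "N x (\<i> * of_real s) = 0"
    using N_cnj[of x "\<i> * of_real s"] by (simp add: vec_eq_iff)
  ultimately show ?thesis using assms by (auto simp: pole_def)
qed

section \<open>Extension of the dressed frame to the poles\<close>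

definition approach :: "complex \<Rightarrow> nat \<Rightarrow> complex"
  where "approach \<sigma> k = \<sigma> * of_real (1 + inverse (of_nat (Suc k)))"

lemma approach_tendsto: "approach \<sigma> \<longlonglongrightarrow> \<sigma>"
proof -
  have "(\<lambda>k. \<sigma> * of_real (1 + inverse (real (Suc k)))) \<longlonglongrightarrow> \<sigma> * of_real (1 + 0)"
    by (intro tendsto_mult tendsto_of_real tendsto_add tendsto_const LIMSEQ_inverse_real_of_nat)
  then show ?thesis by (simp add: approach_def[abs_def])
qed

text \<open>The factor 1 + 1/(k+1) exceeds 1 for every \<open>k\<close>, including
  \<open>k = 0\<close>, so the sequence stays strictly outside the circle through both poles.
  Because the factor is real, the sequence is also compatible with conjugation and negation, which
  lets the symmetries pass to the limit.\<close>

lemma approach_not_pole: "pole \<sigma> \<Longrightarrow> \<not> pole (approach \<sigma> k)"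
proof -
  assume "pole \<sigma>"
  then have "norm (approach \<sigma> k) = \<bar>s\<bar> * (1 + inverse (real (Suc k)))"
    by (auto simp: pole_def approach_def norm_mult simp del: of_real_add of_real_inverse of_nat_Suc)
  also have "\<dots> > \<bar>s\<bar> * 1"
    using s_nonzero by (intro mult_strict_left_mono) auto
  finally show ?thesis by (auto simp: pole_def norm_mult)
qed

lemma approach_cnj: "approach (cnj \<sigma>) k = cnj (approach \<sigma> k)"
  by (simp add: approach_def)

lemma approach_uminus: "approach (- \<sigma>) k = - approach \<sigma> k"
  by (simp add: approach_def)

text \<open>Stated for an arbitrary family \<open>g\<close> because it serves two: the dressed frame
  itself when the limit at the origin is known, and a version normalised at the origin otherwise.
  The reality conditions are closed conditions, so they survive the limit.\<close>

lemma frame_at_poles: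
  fixes g :: "real ^ 'n \<Rightarrow> complex \<Rightarrow> complex ^ ('n + 'n) ^ ('n + 'n)"
  assumes g: "\<And>x \<mu>. \<not> pole \<mu> \<Longrightarrow> ((\<lambda>x. g x \<mu>) has_derivative (\<lambda>v. g x \<mu> ** theta F' \<mu> x v)) (at x)"
    and cnj: "\<And>x \<mu>. \<not> pole \<mu> \<Longrightarrow> map_matrix cnj (g x (cnj \<mu>)) = g x \<mu>"
    and Inn: "\<And>x \<mu>. \<not> pole \<mu> \<Longrightarrow> Inn ** g x \<mu> ** Inn = g x (- \<mu>)"
    and orth: "\<And>x \<mu>. \<not> pole \<mu> \<Longrightarrow> g x \<mu> ** transpose (g x \<mu>) = mat 1"
    and conv: "\<And>\<sigma>. pole \<sigma> \<Longrightarrow> convergent (\<lambda>k. g 0 (approach \<sigma> k))"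
  shows "\<exists>L. \<forall>x \<sigma>. pole \<sigma> \<longrightarrow>
    (\<lambda>k. g x (approach \<sigma> k)) \<longlonglongrightarrow> L x \<sigma> \<and>
    ((\<lambda>x. L x \<sigma>) has_derivative (\<lambda>v. L x \<sigma> ** theta F' \<sigma> x v)) (at x) \<and>
    map_matrix cnj (L x (cnj \<sigma>)) = L x \<sigma> \<and>
    Inn ** L x \<sigma> ** Inn = L x (- \<sigma>) \<and>
    L x \<sigma> ** transpose (L x \<sigma>) = mat 1"
proof -
  interpret M: bounded_bilinear
    "(**) :: complex ^ ('n + 'n) ^ ('n + 'n) \<Rightarrow> complex ^ ('n + 'n) ^ ('n + 'n) \<Rightarrow> complex ^ ('n + 'n) ^ ('n + 'n)"
    by (rule bounded_bilinear_matrix_mult)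
  define L where "L = (\<lambda>x \<sigma>. lim (\<lambda>k. g x (approach \<sigma> k)))"
  obtain C where C: "\<And>(F :: real ^ 'n \<Rightarrow> real ^ 'n ^ 'n) \<mu> \<nu> x v.
      norm (theta F \<mu> x v - theta F \<nu> x v) \<le> norm (\<mu> - \<nu>) * C * norm v"
    using theta_Lipschitz_parameter by metis
  have cont: "continuous_on UNIV F'"
    using solution_F' by (metis C_k.simps(1) is_solution_def smooth_def)
  have \<epsilon>: "(\<lambda>k. norm (approach \<sigma> k - \<sigma>) * C) \<longlonglongrightarrow> 0" for \<sigma>
    using tendsto_mult_left_zero[OF tendsto_norm_zero[OF LIM_zero[OF approach_tendsto]]] by simp
  have lim: "convergent (\<lambda>k. g x (approach \<sigma> k))"
    "((\<lambda>x. L x \<sigma>) has_derivative (\<lambda>v. L x \<sigma> ** theta F' \<sigma> x v)) (at x)"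
    if "pole \<sigma>" for x \<sigma>
    unfolding L_def
    by (rule limit_of_parallel[where g = "\<lambda>k x. g x (approach \<sigma> k)"
          and \<omega> = "\<lambda>k. theta F' (approach \<sigma> k)" and \<omega>' = "theta F' \<sigma>",
          OF g[OF approach_not_pole[OF that]] C \<epsilon> theta_locally_bounded[OF cont] conv[OF that]])+
  have L: "(\<lambda>k. g x (approach \<sigma> k)) \<longlonglongrightarrow> L x \<sigma>" if "pole \<sigma>" for x \<sigma>
    using lim(1)[OF that] unfolding L_def convergent_LIMSEQ_iff .
  show ?thesis
  proof (intro exI[of _ L] allI impI conjI)
    fix x \<sigma> assume \<sigma>: "pole \<sigma>"
    show "(\<lambda>k. g x (approach \<sigma> k)) \<longlonglongrightarrow> L x \<sigma>" by (rule L[OF \<sigma>])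
    show "((\<lambda>x. L x \<sigma>) has_derivative (\<lambda>v. L x \<sigma> ** theta F' \<sigma> x v)) (at x)"
      by (rule lim(2)[OF \<sigma>])
    have np: "\<not> pole (approach \<sigma> k)" for k by (rule approach_not_pole[OF \<sigma>])
    have "(\<lambda>k. map_matrix cnj (g x (approach (cnj \<sigma>) k))) \<longlonglongrightarrow> map_matrix cnj (L x (cnj \<sigma>))"
      using \<sigma> by (intro bounded_linear.tendsto[OF bounded_linear_map_cnj] L) (simp only: pole_cnj)
    then have "(\<lambda>k. g x (approach \<sigma> k)) \<longlonglongrightarrow> map_matrix cnj (L x (cnj \<sigma>))"
      by (simp only: approach_cnj cnj[OF np])
    then show "map_matrix cnj (L x (cnj \<sigma>)) = L x \<sigma>"
      using L[OF \<sigma>] LIMSEQ_unique by blast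
    have "(\<lambda>k. Inn ** g x (approach \<sigma> k) ** Inn) \<longlonglongrightarrow> Inn ** L x \<sigma> ** Inn"
      by (intro M.tendsto tendsto_const L \<sigma>)
    moreover have "(\<lambda>k. g x (approach (- \<sigma>) k)) \<longlonglongrightarrow> L x (- \<sigma>)"
      using \<sigma> by (intro L) (simp only: pole_uminus)
    ultimately show "Inn ** L x \<sigma> ** Inn = L x (- \<sigma>)"
      using LIMSEQ_unique by (auto simp: approach_uminus Inn[OF np])
    have "(\<lambda>k. g x (approach \<sigma> k) ** transpose (g x (approach \<sigma> k))) \<longlonglongrightarrow> L x \<sigma> ** transpose (L x \<sigma>)"
      by (intro M.tendsto bounded_linear.tendsto[OF bounded_linear_ctranspose] L \<sigma>)
    then show "L x \<sigma> ** transpose (L x \<sigma>) = mat 1"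
      by (simp add: orth[OF np] LIMSEQ_const_iff)
  qed
qed

text \<open>Conjugation and negation permute the poles, so the frame conditions at the poles and
  elsewhere never mix; elsewhere they are those of \<open>D\<close>.\<close>

lemma frame_of_extension:
  assumes E': "\<And>x \<mu>. \<not> pole \<mu> \<Longrightarrow> E' x \<mu> = D x \<mu>"
    and L: "\<And>x \<sigma>. pole \<sigma> \<Longrightarrow> ((\<lambda>x. E' x \<sigma>) has_derivative (\<lambda>v. E' x \<sigma> ** theta F' \<sigma> x v)) (at x)"
    "\<And>x \<sigma>. pole \<sigma> \<Longrightarrow> map_matrix cnj (E' x (cnj \<sigma>)) = E' x \<sigma>"
    "\<And>x \<sigma>. pole \<sigma> \<Longrightarrow> Inn ** E' x \<sigma> ** Inn = E' x (- \<sigma>)"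
    "\<And>x \<sigma>. pole \<sigma> \<Longrightarrow> E' x \<sigma> ** transpose (E' x \<sigma>) = mat 1"
  shows "is_dressed s \<beta> b E E' \<and> is_frame F' E'"
proof
  show "is_frame F' E'"
  proof (rule is_frameI)
    fix x \<mu>
    consider "pole \<mu>" | "\<not> pole \<mu>" "\<not> pole (cnj \<mu>)" "\<not> pole (- \<mu>)"
      by (simp only: pole_cnj pole_uminus) blast
    then have "((\<lambda>x. E' x \<mu>) has_derivative (\<lambda>v. E' x \<mu> ** theta F' \<mu> x v)) (at x) \<and>
      map_matrix cnj (E' x (cnj \<mu>)) = E' x \<mu> \<and>
      Inn ** E' x \<mu> ** Inn = E' x (- \<mu>) \<and>
      E' x \<mu> ** transpose (E' x \<mu>) = mat 1"
    proof cases
      case 1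
      show ?thesis by (intro conjI L[OF 1])
    next
      case 2
      note eq = E'[OF 2(1)] E'[OF 2(2)] E'[OF 2(3)]
      show ?thesis
        unfolding eq by (intro conjI has_derivative_D D_cnj D_Inn D_orth[OF 2(1)])
    qed
    then show "((\<lambda>x. E' x \<mu>) has_derivative (\<lambda>v. E' x \<mu> ** theta F' \<mu> x v)) (at x)"
      "map_matrix cnj (E' x (cnj \<mu>)) = E' x \<mu>"
      "Inn ** E' x \<mu> ** Inn = E' x (- \<mu>)"
      "E' x \<mu> ** transpose (E' x \<mu>) = mat 1"
      by blast+
  qed
  show "is_dressed s \<beta> b E E'"
    using E' D_eq_dressed by (simp add: is_dressed_def pole_def)
qed

lemma dressed_frame_exists: "\<exists>E'. is_dressed s \<beta> b E E' \<and> is_frame F' E'"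
proof -
  \<comment> \<open>Left multiplication by a matrix constant in \<open>x\<close> leaves the
    connection unchanged, and this choice also respects the reality conditions. Off the poles the
    product is the identity at the origin, so its limit there exists without any assumption on how
    \<open>E\<close> depends on the parameter.\<close>
  let ?g = "\<lambda>x \<mu>. transpose (D 0 \<mu>) ** D x \<mu>"
  have T: "transpose (D x \<mu>) ** D x \<mu> = mat 1" if "\<not> pole \<mu>" for x \<mu>
    using D_orth[OF that] matrix_left_right_inverse by blast
  have InnT: "transpose Inn = Inn" by (simp add: Inn_def block_simps)
  have "\<exists>L. \<forall>x \<sigma>. pole \<sigma> \<longrightarrow> (\<lambda>k. ?g x (approach \<sigma> k)) \<longlonglongrightarrow> L x \<sigma> \<and>
    ((\<lambda>x. L x \<sigma>) has_derivative (\<lambda>v. L x \<sigma> ** theta F' \<sigma> x v)) (at x) \<and>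
    map_matrix cnj (L x (cnj \<sigma>)) = L x \<sigma> \<and>
    Inn ** L x \<sigma> ** Inn = L x (- \<sigma>) \<and>
    L x \<sigma> ** transpose (L x \<sigma>) = mat 1"
  proof (rule frame_at_poles)
    fix x \<mu> assume \<mu>: "\<not> pole \<mu>"
    show "((\<lambda>x. ?g x \<mu>) has_derivative (\<lambda>v. ?g x \<mu> ** theta F' \<mu> x v)) (at x)"
      using bounded_linear.has_derivative[OF
          bounded_bilinear.bounded_linear_right[OF bounded_bilinear_matrix_mult] has_derivative_D]
      by (simp add: matrix_mul_assoc)
    show "map_matrix cnj (?g x (cnj \<mu>)) = ?g x \<mu>"
      by (simp add: map_cnj_mult map_cnj_simps D_cnj)
    have "Inn ** transpose (D 0 \<mu>) ** Inn = transpose (Inn ** D 0 \<mu> ** Inn)"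
      by (simp add: matrix_transpose_mul InnT matrix_mul_assoc)
    then show "Inn ** ?g x \<mu> ** Inn = ?g x (- \<mu>)"
      by (simp add: Inn_conj_mult D_Inn)
    have "?g x \<mu> ** transpose (?g x \<mu>) =
        transpose (D 0 \<mu>) ** (D x \<mu> ** transpose (D x \<mu>)) ** D 0 \<mu>"
      by (simp add: matrix_transpose_mul matrix_mul_assoc)
    then show "?g x \<mu> ** transpose (?g x \<mu>) = mat 1"
      by (simp add: D_orth[OF \<mu>] T[OF \<mu>])
  next
    fix \<sigma> assume "pole \<sigma>"
    then show "convergent (\<lambda>k. ?g 0 (approach \<sigma> k))"
      by (simp add: T[OF approach_not_pole] convergent_const)
  qed
  then obtain L :: "real ^ 'n \<Rightarrow> complex \<Rightarrow> complex ^ ('n + 'n) ^ ('n + 'n)"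
    where L: "\<And>x \<sigma>. pole \<sigma> \<Longrightarrow>
    ((\<lambda>x. L x \<sigma>) has_derivative (\<lambda>v. L x \<sigma> ** theta F' \<sigma> x v)) (at x) \<and>
    map_matrix cnj (L x (cnj \<sigma>)) = L x \<sigma> \<and>
    Inn ** L x \<sigma> ** Inn = L x (- \<sigma>) \<and>
    L x \<sigma> ** transpose (L x \<sigma>) = mat 1"
    by blast
  let ?E = "\<lambda>x \<mu>. if pole \<mu> then L x \<mu> else D x \<mu>"
  have "is_dressed s \<beta> b E ?E \<and> is_frame F' ?E"
  proof (rule frame_of_extension)
    fix x \<sigma> assume \<sigma>: "pole \<sigma>"
    then have "pole (cnj \<sigma>)" "pole (- \<sigma>)" by (simp_all only: pole_cnj pole_uminus)
    with \<sigma> L[OF \<sigma>] show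
      "((\<lambda>x. ?E x \<sigma>) has_derivative (\<lambda>v. ?E x \<sigma> ** theta F' \<sigma> x v)) (at x)"
      "map_matrix cnj (?E x (cnj \<sigma>)) = ?E x \<sigma>"
      "Inn ** ?E x \<sigma> ** Inn = ?E x (- \<sigma>)"
      "?E x \<sigma> ** transpose (?E x \<sigma>) = mat 1"
      by (simp_all only: if_True)
  qed auto
  then show ?thesis by blast
qed

lemma entire_dressed_frame_exists:
  assumes "entire_in_parameter E"
  shows "\<exists>E'. is_dressed s \<beta> b E E' \<and> is_frame F' E' \<and> entire_in_parameter E'"
proof -
  have N: "(\<lambda>\<mu>. N x \<mu> $ i $ j) holomorphic_on UNIV" for x i j
  proof -
    have "entrywise_holomorphic (E x)"
      using assms by (simp add: entrywise_holomorphic_def entire_in_parameter_def)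
    then have "entrywise_holomorphic (N x)"
      unfolding N_def[abs_def]
      by (intro entrywise_holomorphic_mult entrywise_holomorphic_transpose entrywise_holomorphic_Kmat)
    then show ?thesis by (simp add: entrywise_holomorphic_def)
  qed
  have "\<exists>h. h holomorphic_on UNIV \<and> (\<forall>\<mu>. \<not> pole \<mu> \<longrightarrow> h \<mu> = D x \<mu> $ i $ j)" for x i j
  proof -
    \<comment> \<open>With a = is the denominator z^2 - a^2 is z^2 + s^2, the one in
      \<open>D\<close>; both zeros of the numerator come from \<open>N_pole\<close>.\<close>
    obtain h where "h holomorphic_on UNIV"
      "\<And>z. z \<noteq> \<i> * of_real s \<Longrightarrow> z \<noteq> - (\<i> * of_real s) \<Longrightarrow> h z = N x z $ i $ j / (z\<^sup>2 - (\<i> * of_real s)\<^sup>2)"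
      using holomorphic_quotient_two_zeros[OF N[of x i j], of "\<i> * of_real s"] s_nonzero
        N_pole[of "\<i> * of_real s" x] N_pole[of "- \<i> * of_real s" x] by (auto simp: pole_def)
    then show ?thesis
      by (intro exI[of _ h]) (auto simp: pole_def D_def cscale_def power_mult_distrib)
  qed
  then obtain h where h: "\<And>x i j. h x i j holomorphic_on UNIV"
    "\<And>x i j \<mu>. \<not> pole \<mu> \<Longrightarrow> h x i j \<mu> = D x \<mu> $ i $ j"
    by metis
  define E' where "E' = (\<lambda>x \<mu>. (\<chi> i j. h x i j \<mu>) :: complex ^ ('n + 'n) ^ ('n + 'n))"
  have E'D: "E' x \<mu> = D x \<mu>" if "\<not> pole \<mu>" for x \<mu>
    using h(2)[OF that] by (simp add: vec_eq_iff E'_def)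
  have lim: "(\<lambda>k. D x (approach \<sigma> k)) \<longlonglongrightarrow> E' x \<sigma>" if "pole \<sigma>" for x \<sigma>
  proof -
    have "(\<lambda>k. h x i j (approach \<sigma> k)) \<longlonglongrightarrow> h x i j \<sigma>" for i j
      using holomorphic_on_imp_continuous_on[OF h(1)] approach_tendsto
      by (simp add: continuous_on_eq_continuous_at isCont_tendsto_compose)
    then have "(\<lambda>k. E' x (approach \<sigma> k)) \<longlonglongrightarrow> E' x \<sigma>"
      unfolding E'_def by (intro vec_tendstoI) simp
    then show ?thesis by (simp add: E'D[OF approach_not_pole[OF that]])
  qed
  have conv: "convergent (\<lambda>k. D 0 (approach \<sigma> k))" if "pole \<sigma>" for \<sigma>
    using lim[OF that] convergentI by blast
  from frame_at_poles[OF has_derivative_D D_cnj D_Inn D_orth conv]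
  obtain L where L: "\<And>x \<sigma>. pole \<sigma> \<Longrightarrow> (\<lambda>k. D x (approach \<sigma> k)) \<longlonglongrightarrow> L x \<sigma> \<and>
    ((\<lambda>x. L x \<sigma>) has_derivative (\<lambda>v. L x \<sigma> ** theta F' \<sigma> x v)) (at x) \<and>
    map_matrix cnj (L x (cnj \<sigma>)) = L x \<sigma> \<and>
    Inn ** L x \<sigma> ** Inn = L x (- \<sigma>) \<and>
    L x \<sigma> ** transpose (L x \<sigma>) = mat 1"
    by blast
  \<comment> \<open>Along the approaching sequence the dressed frame tends both to the parallel
    limit and, by continuity, to the value of the entire extension. The extension thus inherits the
    frame conditions at the poles.\<close>
  have LE: "L x \<sigma> = E' x \<sigma>" if "pole \<sigma>" for x \<sigma>
    using L[OF that] lim[OF that] LIMSEQ_unique by blast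
  have "is_dressed s \<beta> b E E' \<and> is_frame F' E'"
  proof (rule frame_of_extension)
    fix x \<sigma> assume \<sigma>: "pole \<sigma>"
    then have "pole (cnj \<sigma>)" "pole (- \<sigma>)" by (simp_all only: pole_cnj pole_uminus)
    with \<sigma> L[OF \<sigma>] LE show
      "((\<lambda>x. E' x \<sigma>) has_derivative (\<lambda>v. E' x \<sigma> ** theta F' \<sigma> x v)) (at x)"
      "map_matrix cnj (E' x (cnj \<sigma>)) = E' x \<sigma>"
      "Inn ** E' x \<sigma> ** Inn = E' x (- \<sigma>)"
      "E' x \<sigma> ** transpose (E' x \<sigma>) = mat 1"
      by simp_all
  qed (auto simp: E'D)
  moreover have "entire_in_parameter E'"
    using h(1) by (simp add: entire_in_parameter_def E'_def)
  ultimately show ?thesis by blast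
qed

end

section \<open>Coordinate form of the Riccati system and conclusion\<close>

lemma dmat_eq_sum: "dmat v = (\<Sum>i\<in>UNIV. v $ i *\<^sub>R Cunit i)"
proof -
  have "(\<Sum>k\<in>UNIV. v $ k * (if i = k \<and> j = k then 1 else 0)) = dmat v $ i $ j" for i j
  proof -
    have "(\<Sum>k\<in>UNIV. v $ k * (if i = k \<and> j = k then 1 else 0)) = (\<Sum>k\<in>UNIV. if k = i then dmat v $ i $ j else 0)"
      by (intro sum.cong) (auto simp: dmat_def)
    then show ?thesis by simp
  qed
  then show ?thesis by (simp add: vec_eq_iff Cunit_def)
qed

text \<open>The tangent vector enters only through \<open>dmat v\<close>, and linearly, so expanding
  this diagonal matrix in the units \<open>Cunit i\<close> gives the sum.\<close>

lemma dressing_deriv_eq_sum: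
  "dressing_deriv s G b v = (\<Sum>i\<in>UNIV. v $ i *\<^sub>R
    (- (b ** (G ** Cunit i - Cunit i ** transpose G)) + (transpose G ** Cunit i - Cunit i ** G) ** b
      - s *\<^sub>R Cunit i + s *\<^sub>R (b ** Cunit i ** b)))"
proof -
  define h where "h M = - (b ** (G ** M - M ** transpose G)) + (transpose G ** M - M ** G) ** b
      - s *\<^sub>R M + s *\<^sub>R (b ** M ** b)" for M
  have lin: "linear h"
    by (rule linearI) (simp_all add: h_def matrix_distribs algebra_simps)
  have "dressing_deriv s G b v = h (dmat v)"
    by (simp add: dressing_deriv_def conn_def h_def matrix_distribs)
  also have "\<dots> = (\<Sum>i\<in>UNIV. v $ i *\<^sub>R h (Cunit i))"
    by (simp only: dmat_eq_sum linear_sum[OF lin] linear_scale[OF lin])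
  finally show ?thesis by (simp only: h_def)
qed

theorem theorem14p3:
  fixes F :: "real ^ 'n \<Rightarrow> real ^ 'n ^ 'n"
    and E :: "real ^ 'n \<Rightarrow> complex \<Rightarrow> complex ^ ('n + 'n) ^ ('n + 'n)"
    and s :: real
    and \<beta> :: "real ^ 'n ^ 'n"
  assumes "is_solution F"
    and "is_frame F E"
    and "s \<noteq> 0"
    and "orthogonal_matrix \<beta>"
  shows "\<exists>b :: real ^ 'n \<Rightarrow> real ^ 'n ^ 'n.
    (\<forall>x. invertible (beta_den s \<beta> E x) \<and>
         cmat (b x) = matrix_inv (beta_den s \<beta> E x) ** beta_num s \<beta> E x) \<and>
    (let F' = (\<lambda>x. transpose (F x) + s *\<^sub>R off_diag (b x)) in
       is_solution F' \<and>
       (\<exists>E'. is_dressed s \<beta> b E E' \<and> is_frame F' E' \<and>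
             (entire_in_parameter E \<longrightarrow> entire_in_parameter E'))) \<and>
    (\<forall>x. (b has_derivative
           (\<lambda>v. \<Sum>i\<in>UNIV. v $ i *\<^sub>R
             (- (b x ** (F x ** Cunit i - Cunit i ** transpose (F x)))
              + (transpose (F x) ** Cunit i - Cunit i ** F x) ** b x
              - s *\<^sub>R Cunit i
              + s *\<^sub>R (b x ** Cunit i ** b x)))) (at x)) \<and>
    (\<forall>x. b x ** transpose (b x) = mat 1)"
proof -
  interpret dressing F E s \<beta>
    using assms by unfold_locales
  have F': "(\<lambda>x. transpose (F x) + s *\<^sub>R off_diag (b x)) = F'"
    by (simp add: fun_eq_iff F'_def)
  have "\<exists>E'. is_dressed s \<beta> b E E' \<and> is_frame F' E' \<and>
      (entire_in_parameter E \<longrightarrow> entire_in_parameter E')"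
    using dressed_frame_exists entire_dressed_frame_exists by metis
  then show ?thesis
    unfolding Let_def
    using beta_den_b solution_F' b_orth(1)
      has_derivative_b[unfolded dressing_deriv_eq_sum[abs_def]]
    by (intro exI[of _ b]) (simp only: F', blast)
qed

end
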